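(* Let $(X,d,m)$ be a non-compact homogeneous ultrametric measure space with a homogeneous hierarchical Laplacian $L_C$ admitting a continuous heat kernel. Let $\mathfrak{p}(t)$ be the on-diagonal heat kernel, $N$ the spectral function and $V_*$ the volume function of the intrinsic metric. Then none of the functions $t\mapsto 1/\mathfrak{p}(t)$, $t\mapsto 1/N(1/t)$, $t\mapsto V_*(t)$ varies regularly (at $\infty$).
   Context: Setting. $(X,d)$ is a non-compact proper ultrametric space (closed balls are compact) and $m$ is a Radon measure on $X$ with $m(X)=\infty$, $m(B)>0$ for each non-singleton closed ball, and $m(\{a\})>0$ if and only if $a$ is isolated. A choice function $C$ assigns to each non-singleton ball $B$ a number $C(B)>0$ such that $\lambda(B):=\sum_{D\supseteq B}C(D)<\infty$ (sum over balls $D$) and $\sum_{B\ni a}C(B)=\infty$ for each non-isolated $a\in X$. The hierarchical Laplacian is $L_Cf(x)=\sum_{B\ni x}C(B)\bigl(f(x)-\frac1{m(B)}\int_Bf\,dm\bigr)$ on locally constant compactly supported $f$. It is essentially self-adjoint in $\mathcal{L}^2(X,m)$; $L_C$ also denotes its self-adjoint extension. Homogeneous means: there is a group of isometries of $(X,d)$ acting transitively on $X$ and leaving both $m$ and $C(\cdot)$ invariant. Consequences and notation. Either (Case 1) $X$ is perfect and the set of distances from any point is $\{0\}\cup\{r_k:k\in\mathbb{Z}\}$ with $r_k<r_{k+1}$, $r_k\to\infty$ as $k\to\infty$, $r_k\to0$ as $k\to-\infty$; or (Case 2) $X$ is countable and discrete and this set is $\{r_k:k\in\mathbb{N}_0\}$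 with $r_0=0$, $r_k<r_{k+1}$, $r_k\to\infty$. Let $\mathcal{B}_k$ be the collection of closed balls of diameter $r_k$. Every ball in $\mathcal{B}_k$ is the disjoint union of the same number $n_k\ge2$ ($n_k<\infty$) of balls in $\mathcal{B}_{k-1}$ ($k\in\mathbb{Z}$, resp. $k\in\mathbb{N}=\{1,2,\dots\}$). The measure is normalised so that $m(B)=1$ for $B\in\mathcal{B}_0$, and $V(k):=m(B)$ for $B\in\mathcal{B}_k$, i.e. $V(0)=1$ and $V(k)/V(k-1)=n_k$. Put $\lambda_k:=\lambda(B)$ for $B\in\mathcal{B}_k$ and $s_k:=1/\lambda_k$ ($k\in\mathbb{Z}$, resp. $k\in\mathbb{N}$). The intrinsic ultrametric $d_*$ is given by $d_*(x,y)=s_k$ if $d(x,y)=r_k$, $x\ne y$. $V_*(s):=m(\{y:d_*(x,y)\le s\})$ for $s>0$, which is independent of $x$ and equals $V(k)$ for $s\in[s_k,s_{k+1})$ (in Case 2, $V_*(s)=1$ for $0<s<s_1$). The spectral function is $N(\tau)=1/V_*(1/\tau)$, $\tau>0$. The on-diagonal heat kernel $\mathfrak{p}(t)=\mathfrak{p}(t,x,x)$, $t>0$, where $\mathfrak{p}(t,x,y)$ is the continuous kernel of $e^{-tL_C}$ with respect to $m$, is independent of $x$ and given by $$\mathfrak{p}(t)=\int_0^\infty e^{-t\tau}\,dN(\tau)=\sum_k e^{-t\lambda_k}\Bigl(\frac1{V(k-1)}-\frac1{V(k)}\Bigr)<\infty ,$$ summed over $k\in\mathbb{Z}$ in Case 1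 and $k\in\mathbb{N}$ in Case 2. A positive function $F$ varies regularly of index $\alpha\in\mathbb{R}$ if $\lim_{t\to\infty}F(\kappa t)/F(t)=\kappa^\alpha$ for all $\kappa\ge1$; it varies regularly if this holds for some $\alpha$. *)

theory Defs
  imports "HOL-Analysis.Analysis"
begin

section \<open>Ultrametric measure spaces and choice functions\<close>

(* The condition r > 0 only excludes the empty balls of negative radius, which are
   not singletons either; a ball of radius 0 is a singleton. *)
definition nonsingleton_balls :: "'a::metric_space set set" where
  "nonsingleton_balls = {cball x r |x r. r > 0 \<and> \<not> is_singleton (cball x r)}"

definition radon_measure :: "'a::topological_space measure \<Rightarrow> bool" where
  "radon_measure m \<longleftrightarrow>
     sets m = sets borel \<and>
     (\<forall>K. compact K \<longrightarrow> emeasure m K < \<infinity>) \<and>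
     (\<forall>A\<in>sets borel. emeasure m A = (SUP K\<in>{K. K \<subseteq> A \<and> compact K}. emeasure m K))"

locale ultrametric_measure_space =
  fixes m :: "'a::metric_space measure"
  assumes ultrametric: "\<And>x y z::'a. dist x z \<le> max (dist x y) (dist y z)"
    and proper: "\<And>(x::'a) r. compact (cball x r)"
    and noncompact: "\<not> compact (UNIV :: 'a set)"
    and radon: "radon_measure m"
    and infinite_mass: "emeasure m UNIV = \<infinity>"
    and ball_pos: "\<And>B. B \<in> nonsingleton_balls \<Longrightarrow> emeasure m B > 0"
    and point_pos_iff: "\<And>a. emeasure m {a} > 0 \<longleftrightarrow> a isolated_in UNIV"

(* For the positive terms C B, failure of summability means that the sum is infinite. *)
locale ultrametric_measure_space_choice = ultrametric_measure_space m
  for m :: "'a::metric_space measure" +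
  fixes C :: "'a set \<Rightarrow> real"
  assumes C_pos: "\<And>B. B \<in> nonsingleton_balls \<Longrightarrow> C B > 0"
    and C_summable_above:
      "\<And>B. B \<in> nonsingleton_balls \<Longrightarrow> C summable_on {D \<in> nonsingleton_balls. B \<subseteq> D}"
    and C_not_summable_at:
      "\<And>a. \<not> a isolated_in UNIV \<Longrightarrow> \<not> C summable_on {B \<in> nonsingleton_balls. a \<in> B}"

definition isometry_group :: "('a::metric_space \<Rightarrow> 'a) set \<Rightarrow> bool" where
  "isometry_group G \<longleftrightarrow>
     (\<forall>g\<in>G. bij g \<and> (\<forall>x y. dist (g x) (g y) = dist x y)) \<and>
     id \<in> G \<and> (\<forall>g\<in>G. \<forall>h\<in>G. g \<circ> h \<in> G) \<and> (\<forall>g\<in>G. inv g \<in> G)"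

locale homogeneous_hierarchical_laplacian = ultrametric_measure_space_choice m C
  for m :: "'a::metric_space measure" and C :: "'a set \<Rightarrow> real" +
  assumes homogeneous:
    "\<exists>G :: ('a \<Rightarrow> 'a) set. isometry_group G \<and>
       (\<forall>x y. \<exists>g\<in>G. g x = y) \<and>
       (\<forall>g\<in>G. \<forall>A\<in>sets borel. emeasure m (g ` A) = emeasure m A) \<and>
       (\<forall>g\<in>G. \<forall>B\<in>nonsingleton_balls. C (g ` B) = C B)"


section \<open>The intrinsic metric, its volume function and the spectral function\<close>

definition eigval :: "('a::metric_space set \<Rightarrow> real) \<Rightarrow> 'a set \<Rightarrow> real" where
  "eigval C B = (\<Sum>\<^sub>\<infinity>D\<in>{D \<in> nonsingleton_balls. B \<subseteq> D}. C D)"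

(* For x \<noteq> y in an ultrametric space, cball x (dist x y) is the smallest ball that contains
   both points; its diameter is dist x y, so if dist x y = r_k the value below is
   s_k = 1 / lambda_k. *)
definition intrinsic_dist :: "('a::metric_space set \<Rightarrow> real) \<Rightarrow> 'a \<Rightarrow> 'a \<Rightarrow> real" where
  "intrinsic_dist C x y = (if x = y then 0 else 1 / eigval C (cball x (dist x y)))"

definition intrinsic_vol ::
  "'a::metric_space measure \<Rightarrow> ('a set \<Rightarrow> real) \<Rightarrow> 'a \<Rightarrow> real \<Rightarrow> real" where
  "intrinsic_vol m C x s = measure m {y. intrinsic_dist C x y \<le> s}"

definition spectral_fun ::
  "'a::metric_space measure \<Rightarrow> ('a set \<Rightarrow> real) \<Rightarrow> 'a \<Rightarrow> real \<Rightarrow> real" where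
  "spectral_fun m C x \<tau> = 1 / intrinsic_vol m C x (1 / \<tau>)"


section \<open>The hierarchical Laplacian\<close>

definition test_functions :: "('a::metric_space \<Rightarrow> real) set" where
  "test_functions =
     {f. (\<forall>x. \<exists>U. open U \<and> x \<in> U \<and> f constant_on U) \<and> compact (closure {x. f x \<noteq> 0})}"

definition hier_laplacian ::
  "'a::metric_space measure \<Rightarrow> ('a set \<Rightarrow> real) \<Rightarrow> ('a \<Rightarrow> real) \<Rightarrow> 'a \<Rightarrow> real" where
  "hier_laplacian m C f x =
     (\<Sum>\<^sub>\<infinity>B\<in>{B \<in> nonsingleton_balls. x \<in> B}.
        C B * (f x - (1 / measure m B) * (LINT y:B|m. f y)))"

(* Elements of the Hilbert space L^2(X,m) are represented by square integrable functions, with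
   equality almost everywhere.  An unbounded operator is its graph, a set of pairs. *)
definition L2 :: "'a measure \<Rightarrow> ('a \<Rightarrow> real) set" where
  "L2 m = {f \<in> borel_measurable m. integrable m (\<lambda>x. (f x)\<^sup>2)}"

definition L2_inner :: "'a measure \<Rightarrow> ('a \<Rightarrow> real) \<Rightarrow> ('a \<Rightarrow> real) \<Rightarrow> real" where
  "L2_inner m f g = (LINT x|m. f x * g x)"

definition L2_norm :: "'a measure \<Rightarrow> ('a \<Rightarrow> real) \<Rightarrow> real" where
  "L2_norm m f = sqrt (L2_inner m f f)"

type_synonym 'a L2_operator = "(('a \<Rightarrow> real) \<times> ('a \<Rightarrow> real)) set"

definition hier_laplacian_graph ::
  "'a::metric_space measure \<Rightarrow> ('a set \<Rightarrow> real) \<Rightarrow> 'a L2_operator" where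
  "hier_laplacian_graph m C = {(f, hier_laplacian m C f) |f. f \<in> test_functions}"

definition L2_adjoint :: "'a measure \<Rightarrow> 'a L2_operator \<Rightarrow> 'a L2_operator" where
  "L2_adjoint m A =
     {(f, g). f \<in> L2 m \<and> g \<in> L2 m \<and> (\<forall>(u, v)\<in>A. L2_inner m v f = L2_inner m u g)}"

definition self_adjoint_extension ::
  "'a measure \<Rightarrow> 'a L2_operator \<Rightarrow> 'a L2_operator \<Rightarrow> bool" where
  "self_adjoint_extension m T A \<longleftrightarrow> T \<subseteq> A \<and> L2_adjoint m A = A"


section \<open>The heat semigroup and the heat kernel\<close>

(* P t = exp (- t A): the strongly continuous semigroup of bounded linear operators on L^2 whose
   infinitesimal generator, domain included, is - A.  The bound, together with linearity, makes
   P t respect equality almost everywhere. *)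
definition semigroup_generated_by_minus ::
  "'a measure \<Rightarrow> 'a L2_operator \<Rightarrow> (real \<Rightarrow> ('a \<Rightarrow> real) \<Rightarrow> ('a \<Rightarrow> real)) \<Rightarrow> bool" where
  "semigroup_generated_by_minus m A P \<longleftrightarrow>
     (\<forall>t\<ge>0. \<forall>f\<in>L2 m. P t f \<in> L2 m) \<and>
     (\<forall>t\<ge>0. \<forall>f\<in>L2 m. \<forall>g\<in>L2 m. \<forall>a b.
        AE x in m. P t (\<lambda>y. a * f y + b * g y) x = a * P t f x + b * P t g x) \<and>
     (\<forall>t\<ge>0. \<exists>K. \<forall>f\<in>L2 m. L2_norm m (P t f) \<le> K * L2_norm m f) \<and>
     (\<forall>f\<in>L2 m. AE x in m. P 0 f x = f x) \<and>
     (\<forall>s\<ge>0. \<forall>t\<ge>0. \<forall>f\<in>L2 m. AE x in m. P (s + t) f x = P s (P t f) x) \<and>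
     (\<forall>f\<in>L2 m. ((\<lambda>t. L2_norm m (\<lambda>x. P t f x - f x)) \<longlongrightarrow> 0) (at_right 0)) \<and>
     (\<forall>f\<in>L2 m. \<forall>g\<in>L2 m. (f, g) \<in> A \<longleftrightarrow>
        ((\<lambda>t. L2_norm m (\<lambda>x. (P t f x - f x) / t - (- g x))) \<longlongrightarrow> 0) (at_right 0))"

definition continuous_kernel_of ::
  "'a::topological_space measure \<Rightarrow> (real \<Rightarrow> ('a \<Rightarrow> real) \<Rightarrow> ('a \<Rightarrow> real)) \<Rightarrow>
     (real \<Rightarrow> 'a \<Rightarrow> 'a \<Rightarrow> real) \<Rightarrow> bool" where
  "continuous_kernel_of m P p \<longleftrightarrow>
     (\<forall>t>0. continuous_on UNIV (\<lambda>(x, y). p t x y)) \<and>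
     (\<forall>t>0. \<forall>f\<in>L2 m. AE x in m.
        integrable m (\<lambda>y. p t x y * f y) \<and> P t f x = (LINT y|m. p t x y * f y))"

(* The hierarchical Laplacian is essentially self-adjoint, so its self-adjoint extension A is
   unique. *)
definition continuous_heat_kernel ::
  "'a::metric_space measure \<Rightarrow> ('a set \<Rightarrow> real) \<Rightarrow> (real \<Rightarrow> 'a \<Rightarrow> 'a \<Rightarrow> real) \<Rightarrow> bool" where
  "continuous_heat_kernel m C p \<longleftrightarrow>
     (\<exists>A P. self_adjoint_extension m (hier_laplacian_graph m C) A \<and>
            semigroup_generated_by_minus m A P \<and>
            continuous_kernel_of m P p)"


section \<open>Regular variation\<close>

(* The notion is meant for functions F that are positive on the positive half-line; positivity is
   not part of the predicate, so that its negation really denies the limit relation. *)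
definition varies_regularly_of_index :: "(real \<Rightarrow> real) \<Rightarrow> real \<Rightarrow> bool" where
  "varies_regularly_of_index F \<alpha> \<longleftrightarrow>
     (\<forall>\<kappa>\<ge>1. ((\<lambda>t. F (\<kappa> * t) / F t) \<longlongrightarrow> \<kappa> powr \<alpha>) at_top)"

definition varies_regularly :: "(real \<Rightarrow> real) \<Rightarrow> bool" where
  "varies_regularly F \<longleftrightarrow> (\<exists>\<alpha>. varies_regularly_of_index F \<alpha>)"

end

theory Submission
  imports Defs
begin

text \<open>Fix the point \<open>x\<close>.  By properness its distances to other points form a discrete subset of the
positive half-line.  For a distance \<open>r\<close>, the closed ball \<open>cball x r\<close> contains, by homogeneity, a
disjoint copy of the open ball \<open>ball x r\<close>, so its mass is at least twice as large
(\<open>ball_mass_doubling\<close>).  This doubling at arbitrarily large scales is what excludes regular variation.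

For the volume function it is a jump by a factor of at least \<open>2\<close> at arbitrarily large arguments,
whereas a regularly varying function \<open>F\<close> has \<open>F (\<kappa> t) / F t\<close> close to \<open>1\<close> if \<open>t\<close> is large and \<open>\<kappa>\<close>
is close to \<open>1\<close> (\<open>doubling_jumps_not_varies_regularly\<close>).  The function \<open>1 / N (1 / t)\<close> is the volume
function itself.

The heat kernel smooths the jumps out, but \<open>p t x x\<close> is the Laplace transform of a discrete measure
\<open>dN\<close>, and doubling means that arbitrarily close to \<open>0\<close> there are points \<open>\<lambda>\<close> whose atom carries at
least half of \<open>N(\<lambda>)\<close>.  If \<open>1 / p\<close> varied regularly, the rescaled measures would converge, and the
limit would have atoms of a fixed mass at infinitely many places
(\<open>atomic_laplace_transform_not_varies_regularly\<close>).

The spectral formula for \<open>p t x x\<close> (\<open>heat_kernel_diagonal_has_sum\<close>) has to be extracted from the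
definition of \<open>p\<close> as a continuous kernel of a semigroup whose generator extends the negative of the
hierarchical Laplacian.  The difference of the averaging densities of \<open>ball x r\<close> and \<open>cball x r\<close> is an
eigenfunction (\<open>haar_eigenfunction\<close>), and the semigroup acts on it by an exponential factor
(\<open>semigroup_eigenvector\<close>).  The latter rests on the boundedness of the semigroup near time \<open>0\<close>,
hence on a uniform boundedness principle in \<open>L\<^sup>2\<close>.  The averaging density of a small ball is a sum of
such eigenfunctions, and averages of the kernel over small balls tend to \<open>p t x x\<close>.\<close>

section \<open>Obstructions to regular variation\<close>

text \<open>A regularly varying function of index \<open>\<alpha>\<close> satisfies \<open>F (\<kappa> t) / F t \<longlonglongrightarrow> \<kappa> powr \<alpha>\<close>, and
\<open>\<kappa> powr \<alpha> < 2\<close> once \<open>\<kappa> > 1\<close> is close to \<open>1\<close>.  A jump by the factor \<open>2\<close> at \<open>T\<close> lies between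
\<open>T / \<kappa>\<close> and \<open>T\<close>, however close \<open>\<kappa>\<close> is to \<open>1\<close>.\<close>
lemma doubling_jumps_not_varies_regularly:
  fixes F :: "real \<Rightarrow> real"
  assumes pos: "\<forall>\<^sub>F s in at_top. 0 < F s"
    and jumps: "\<exists>\<^sub>F T in at_top. \<forall>s<T. 2 * F s \<le> F T"
  shows "\<not> varies_regularly F"
proof
  assume "varies_regularly F"
  then obtain \<alpha> where lim: "\<And>\<kappa>. \<kappa> \<ge> 1 \<Longrightarrow> ((\<lambda>t. F (\<kappa> * t) / F t) \<longlongrightarrow> \<kappa> powr \<alpha>) at_top"
    unfolding varies_regularly_def varies_regularly_of_index_def by blast
  have "((\<lambda>\<kappa>. \<kappa> powr \<alpha>) \<longlongrightarrow> 1 powr \<alpha>) (at_right 1)"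
    by (intro tendsto_powr tendsto_ident_at tendsto_const) auto
  then have "\<forall>\<^sub>F \<kappa> in at_right 1. \<kappa> powr \<alpha> < 2"
    by (rule order_tendstoD(2)) simp
  moreover have "\<forall>\<^sub>F \<kappa>::real in at_right 1. 1 < \<kappa>"
    by (simp add: eventually_at_right_less)
  ultimately have "\<forall>\<^sub>F \<kappa> in at_right 1. 1 < \<kappa> \<and> \<kappa> powr \<alpha> < 2"
    by eventually_elim auto
  then obtain \<kappa> where \<kappa>: "\<kappa> > 1" "\<kappa> powr \<alpha> < 2"
    using eventually_happens[of _ "at_right (1::real)"] by (auto simp: trivial_limit_at_right_real)
  have "\<forall>\<^sub>F t in at_top. F (\<kappa> * t) / F t < 2"
    using order_tendstoD(2)[OF lim \<kappa>(2)] \<kappa>(1) by simp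
  with pos have "\<forall>\<^sub>F t in at_top. F (\<kappa> * t) < 2 * F t"
    by eventually_elim (simp add: field_simps)
  moreover have "filterlim (\<lambda>T. T / \<kappa>) at_top at_top"
    unfolding divide_inverse mult.commute[of _ "inverse \<kappa>"]
    using \<kappa>(1) by (intro filterlim_tendsto_pos_mult_at_top[OF tendsto_const _ filterlim_ident]) simp
  ultimately have "\<forall>\<^sub>F T in at_top. F (\<kappa> * (T / \<kappa>)) < 2 * F (T / \<kappa>)"
    by (rule eventually_compose_filterlim)
  then have "\<forall>\<^sub>F T in at_top. 0 < T \<and> F T < 2 * F (T / \<kappa>)"
    using eventually_gt_at_top[of "0::real"] by eventually_elim (use \<kappa> in auto)
  then have "\<exists>\<^sub>F T::real in at_top. False"
  proof (rule frequently_rev_mp[OF jumps, OF eventually_mono])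
    fix T assume *: "0 < T \<and> F T < 2 * F (T / \<kappa>)"
    then have "T / \<kappa> < T" using \<kappa> by (simp add: divide_less_eq)
    with * show "(\<forall>s<T. 2 * F s \<le> F T) \<longrightarrow> False" by (meson not_le)
  qed
  then show False by simp
qed

text \<open>The polynomial \<open>(1 - (u - w)\<^sup>2) ^ n\<close> is a bump of height \<open>1\<close> at \<open>w\<close> that concentrates there as \<open>n\<close>
grows.  The points \<open>w i\<close> are separated, so any \<open>u\<close> is close to at most one of them; that bump
contributes at most \<open>1\<close>, and for large \<open>n\<close> all others together contribute at most \<open>1\<close>.\<close>
lemma bumps_sum_le_2:
  fixes w :: "nat \<Rightarrow> real"
  assumes w: "\<And>i. i < M \<Longrightarrow> 0 \<le> w i \<and> w i \<le> 1" and inj: "inj_on w {..<M}"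
  obtains n where "\<And>u. 0 \<le> u \<Longrightarrow> u \<le> 1 \<Longrightarrow> (\<Sum>i<M. (1 - (u - w i)\<^sup>2) ^ n) \<le> 2"
proof -
  define D where "D = insert 1 ((\<lambda>(i, j). \<bar>w i - w j\<bar>) ` {(i, j). i < M \<and> j < M \<and> i \<noteq> j})"
  have "finite {(i, j). i < M \<and> j < M \<and> i \<noteq> j}"
    by (rule finite_subset[of _ "{..<M} \<times> {..<M}"]) auto
  then have fin: "finite D" unfolding D_def by simp
  define \<delta> where "\<delta> = Min D"
  have "\<delta> \<in> D" unfolding \<delta>_def using fin by (intro Min_in) (auto simp: D_def)
  then have \<delta>0: "\<delta> > 0" using inj by (auto simp: D_def inj_on_def)
  have sep: "\<delta> \<le> \<bar>w i - w j\<bar>" if "i < M" "j < M" "i \<noteq> j" for i j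
    unfolding \<delta>_def using fin that by (intro Min_le) (auto simp: D_def)
  have \<delta>1: "\<delta> \<le> 1" unfolding \<delta>_def using fin by (intro Min_le) (auto simp: D_def)
  have "\<delta>\<^sup>2 \<le> 1" using \<delta>0 \<delta>1 by (simp add: power_le_one)
  then have "1 - \<delta>\<^sup>2 / 4 < 1" "0 \<le> 1 - \<delta>\<^sup>2 / 4" using \<delta>0 by simp_all
  then obtain n where n: "(1 - \<delta>\<^sup>2 / 4) ^ n < 1 / (real M + 1)"
    using real_arch_pow_inv[of "1 / (real M + 1)" "1 - \<delta>\<^sup>2 / 4"] by auto
  show thesis
  proof (rule that)
    fix u :: real assume u: "0 \<le> u" "u \<le> 1"
    have sq: "(u - w i)\<^sup>2 \<le> 1" if "i < M" for i
      using u w[OF that] by (simp add: abs_square_le_1 abs_le_iff)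
    have small: "(1 - (u - w i)\<^sup>2) ^ n \<le> 1 / (real M + 1)" if "i < M" "\<delta> / 2 \<le> \<bar>u - w i\<bar>" for i
    proof -
      have "(\<delta> / 2)\<^sup>2 \<le> \<bar>u - w i\<bar>\<^sup>2" using that \<delta>0 by (intro power_mono) auto
      then have "1 - (u - w i)\<^sup>2 \<le> 1 - \<delta>\<^sup>2 / 4" by (simp add: power_divide)
      then have "(1 - (u - w i)\<^sup>2) ^ n \<le> (1 - \<delta>\<^sup>2 / 4) ^ n" using sq[OF that(1)] by (intro power_mono) auto
      with n show ?thesis by simp
    qed
    \<comment> \<open>The bumps whose centre is closer to \<open>u\<close> than half the separation: at most one.\<close>
    define J where "J = {i. i < M \<and> \<bar>u - w i\<bar> < \<delta> / 2}"
    have "J \<subseteq> {..<M}" by (auto simp: J_def)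
    have J1: "card J \<le> 1"
    proof (rule ccontr)
      assume "\<not> card J \<le> 1"
      then obtain i j where ij: "i \<in> J" "j \<in> J" "i \<noteq> j"
        by (metis One_nat_def card_le_Suc0_iff_eq card.infinite not_le le0)
      then have "\<bar>w i - w j\<bar> < \<delta>" unfolding J_def mem_Collect_eq by arith
      moreover have "\<delta> \<le> \<bar>w i - w j\<bar>" using ij by (intro sep) (auto simp: J_def)
      ultimately show False by simp
    qed
    have "(\<Sum>i<M. (1 - (u - w i)\<^sup>2) ^ n)
        = (\<Sum>i\<in>J. (1 - (u - w i)\<^sup>2) ^ n) + (\<Sum>i\<in>{..<M} - J. (1 - (u - w i)\<^sup>2) ^ n)"
      using sum.subset_diff[OF \<open>J \<subseteq> {..<M}\<close>] by (simp add: add.commute)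
    also have "\<dots> \<le> (\<Sum>i\<in>J. 1) + (\<Sum>i\<in>{..<M} - J. 1 / (real M + 1))"
      using small sq by (intro add_mono sum_mono power_le_one) (auto simp: J_def)
    also have "\<dots> \<le> 1 + real M * (1 / (real M + 1))"
    proof (intro add_mono)
      show "(\<Sum>i\<in>J. 1::real) \<le> 1" using J1 by simp
      have "card ({..<M} - J) \<le> M" using card_mono[of "{..<M}" "{..<M} - J"] by auto
      then show "(\<Sum>i\<in>{..<M} - J. 1 / (real M + 1)) \<le> real M * (1 / (real M + 1))"
        by (simp add: divide_right_mono)
    qed
    also have "\<dots> \<le> 2" by (simp add: field_simps)
    finally show "(\<Sum>i<M. (1 - (u - w i)\<^sup>2) ^ n) \<le> 2" .
  qed
qed

lemma has_sum_sum:
  fixes f :: "'i \<Rightarrow> 'j \<Rightarrow> real"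
  assumes "finite A" "\<And>i. i \<in> A \<Longrightarrow> (f i has_sum S i) I"
  shows "((\<lambda>j. \<Sum>i\<in>A. f i j) has_sum (\<Sum>i\<in>A. S i)) I"
  using assms by (induction A rule: finite_induct) (auto intro!: has_sum_add)

text \<open>This takes the place of Karamata's Tauberian theorem.  Let \<open>\<nu>\<^sub>t\<close> be the probability measure on
\<open>[0, 1]\<close> that gives the point \<open>u\<^sub>i = exp (- t * lam i)\<close> the weight \<open>a i * u\<^sub>i / p t\<close>.  Its \<open>j\<close>-th
moment is \<open>p ((j + 1) t) / p t\<close>, so if \<open>1 / p\<close> varies regularly, then the integral of every
polynomial with respect to \<open>\<nu>\<^sub>t\<close> converges as \<open>t \<rightarrow> \<infinity>\<close>.

Let \<open>lam k\<close> be small and let \<open>a k\<close> be at least half of the total weight of \<open>{i. lam i \<le> lam k}\<close>.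
Then \<open>a k\<close> is at least a fixed positive multiple of \<open>p (1 / lam k)\<close>.  Hence, for every \<open>\<theta> \<in> [1, 2]\<close>, the
measure \<open>\<nu>\<^sub>t\<close> with \<open>t = \<theta> / lam k\<close> has at \<open>exp (- \<theta>)\<close> an atom whose mass is at least some \<open>d > 0\<close>
that depends neither on \<open>\<theta>\<close> nor on \<open>k\<close>.  The limit functional therefore gives every bump centred
at such a point \<open>exp (- \<theta>)\<close> at least the value \<open>d\<close>.  With more than \<open>2 / d\<close> many \<open>\<theta>\<close> this
contradicts the bound \<open>2\<close> for the sum of the bumps.\<close>
lemma atomic_laplace_transform_not_varies_regularly:
  fixes a lam :: "'i \<Rightarrow> real" and p :: "real \<Rightarrow> real"
  assumes a_pos: "\<And>i. i \<in> I \<Longrightarrow> 0 < a i" and lam_pos: "\<And>i. i \<in> I \<Longrightarrow> 0 < lam i"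
    and p: "\<And>t. t > 0 \<Longrightarrow> ((\<lambda>i. a i * exp (- t * lam i)) has_sum p t) I"
    and atoms: "\<And>e. e > 0 \<Longrightarrow>
      \<exists>k\<in>I. lam k < e \<and> (\<forall>J. finite J \<longrightarrow> J \<subseteq> {i \<in> I. lam i \<le> lam k} \<longrightarrow> sum a J \<le> 2 * a k)"
  shows "\<not> varies_regularly (\<lambda>t. 1 / p t)"
proof
  assume "varies_regularly (\<lambda>t. 1 / p t)"
  then obtain \<alpha> where lim: "\<And>\<kappa>. \<kappa> \<ge> 1 \<Longrightarrow> ((\<lambda>t. (1 / p (\<kappa> * t)) / (1 / p t)) \<longlongrightarrow> \<kappa> powr \<alpha>) at_top"
    unfolding varies_regularly_def varies_regularly_of_index_def by blast
  define u where "u = (\<lambda>t i. exp (- t * lam i))"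
  have u01: "0 < u t i" "u t i \<le> 1" if "t > 0" "i \<in> I" for t i
    using lam_pos[OF that(2)] that(1) by (simp_all add: u_def)
  have term_le: "a i * u t i \<le> p t" if "t > 0" "i \<in> I" for t i
    using finite_sum_le_has_sum[OF p[OF that(1)], of "{i}"] that a_pos
    by (auto simp: u_def less_imp_le)
  have p_pos: "p t > 0" if "t > 0" for t
  proof -
    obtain k where "k \<in> I" using atoms[of 1] by auto
    then have "0 < a k * u t k" using a_pos u01 that by simp
    with term_le[OF that \<open>k \<in> I\<close>] show ?thesis by simp
  qed
  have p_antimono: "p t \<le> p s" if "0 < s" "s \<le> t" for s t
    using that a_pos lam_pos
    by (intro has_sum_mono[OF p p]) (auto simp: mult_left_mono mult_right_mono less_imp_le)
  have ratio: "((\<lambda>t. p (\<kappa> * t) / p t) \<longlongrightarrow> \<kappa> powr - \<alpha>) at_top" if "\<kappa> \<ge> 1" for \<kappa>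
    using tendsto_inverse[OF lim[OF that]] that by (simp add: powr_minus)
  have moments: "((\<lambda>i. a i * u t i * poly g (u t i)) has_sum
      (\<Sum>j\<le>degree g. coeff g j * p (real (Suc j) * t))) I" if "t > 0" for g t
  proof -
    have "((\<lambda>i. coeff g j * (a i * exp (- (real (Suc j) * t) * lam i))) has_sum
        coeff g j * p (real (Suc j) * t)) I" for j
      using that by (intro has_sum_cmult_right p) simp
    then have "((\<lambda>i. \<Sum>j\<le>degree g. coeff g j * (a i * exp (- (real (Suc j) * t) * lam i))) has_sum
        (\<Sum>j\<le>degree g. coeff g j * p (real (Suc j) * t))) I"
      by (intro has_sum_sum) auto
    moreover have "exp (- (real (Suc j) * t) * lam i) = u t i * u t i ^ j" for i j
      by (simp add: u_def exp_of_nat_mult[symmetric] exp_add[symmetric] algebra_simps)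
    ultimately show ?thesis
      by (simp add: poly_altdef sum_distrib_left mult_ac)
  qed
  define L where "L g = (\<Sum>j\<le>degree g. coeff g j * real (Suc j) powr - \<alpha>)" for g :: "real poly"
  have L: "((\<lambda>t. (\<Sum>j\<le>degree g. coeff g j * p (real (Suc j) * t)) / p t) \<longlongrightarrow> L g) at_top" for g
    unfolding L_def sum_divide_distrib times_divide_eq_right[symmetric]
    by (intro tendsto_intros ratio) simp
  \<comment> \<open>The polynomial \<open>u ^ n * (u - exp (-1))\<close> is at most \<open>1\<close> on \<open>[0, 1]\<close> and negative below \<open>exp (-1)\<close>,
     so its integral bounds the mass of \<open>[exp (-1), 1]\<close> from below; for large \<open>n\<close> its limit is positive.\<close>
  obtain n :: nat where n: "exp (-1) < (real (Suc (Suc n)) / real (Suc n)) powr - \<alpha>"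
  proof -
    have "((\<lambda>n. (real (Suc (Suc n)) / real (Suc n)) powr - \<alpha>) \<longlongrightarrow> 1 powr - \<alpha>) sequentially"
      by (intro tendsto_powr tendsto_const LIMSEQ_Suc[OF LIMSEQ_Suc_n_over_n]) simp
    then have "\<forall>\<^sub>F n in sequentially. exp (-1) < (real (Suc (Suc n)) / real (Suc n)) powr - \<alpha>"
      by (rule order_tendstoD(1)) simp
    then show thesis using that eventually_happens' sequentially_bot by blast
  qed
  define c where "c = (real (Suc (Suc n)) powr - \<alpha> - exp (-1) * real (Suc n) powr - \<alpha>) / 2"
  have "exp (-1) * real (Suc n) powr - \<alpha> < real (Suc (Suc n)) powr - \<alpha>"
    using n by (simp add: powr_divide pos_less_divide_eq)
  then have c: "c > 0" "c < real (Suc (Suc n)) powr - \<alpha> - exp (-1) * real (Suc n) powr - \<alpha>"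
    by (simp_all add: c_def)
  have "((\<lambda>t. p (real (Suc (Suc n)) * t) / p t - exp (-1) * (p (real (Suc n) * t) / p t)) \<longlongrightarrow>
      real (Suc (Suc n)) powr - \<alpha> - exp (-1) * real (Suc n) powr - \<alpha>) at_top"
    by (intro tendsto_intros ratio) auto
  from order_tendstoD(1)[OF this c(2)]
  obtain T0 where T0: "\<And>t. t \<ge> T0 \<Longrightarrow>
      c < p (real (Suc (Suc n)) * t) / p t - exp (-1) * (p (real (Suc n) * t) / p t)"
    by (auto simp: eventually_at_top_linorder)
  \<comment> \<open>The choice \<open>t = 1 / lam k\<close> makes \<open>u t i \<ge> exp (-1)\<close> equivalent to \<open>lam i \<le> lam k\<close>.\<close>
  have big_atom: "c / 2 * p (1 / lam k) \<le> a k" if k: "k \<in> I" "1 / lam k \<ge> T0"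
    and dom: "\<forall>J. finite J \<longrightarrow> J \<subseteq> {i \<in> I. lam i \<le> lam k} \<longrightarrow> sum a J \<le> 2 * a k" for k
  proof -
    define t where "t = 1 / lam k"
    have t: "t > 0" "T0 \<le> t" using k lam_pos by (simp_all add: t_def)
    have eu: "exp (- (real (Suc j) * t) * lam i) = u t i ^ Suc j" for i j
      by (simp only: u_def exp_of_nat_mult[symmetric]) (simp add: algebra_simps)
    have "((\<lambda>i. a i * exp (- (real (Suc (Suc n)) * t) * lam i) +
        (- exp (-1)) * (a i * exp (- (real (Suc n) * t) * lam i))) has_sum
        p (real (Suc (Suc n)) * t) + (- exp (-1)) * p (real (Suc n) * t)) I"
      using t by (intro has_sum_add has_sum_cmult_right p) auto
    then have hs: "((\<lambda>i. a i * u t i ^ Suc n * (u t i - exp (-1))) has_sum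
        p (real (Suc (Suc n)) * t) - exp (-1) * p (real (Suc n) * t)) I"
      unfolding eu by (simp add: right_diff_distrib mult_ac)
    have "p (real (Suc (Suc n)) * t) - exp (-1) * p (real (Suc n) * t) \<le> 2 * a k"
    proof (rule has_sum_le_finite_sums[OF hs])
      fix J assume J: "finite J" "J \<subseteq> I"
      define J' where "J' = {i \<in> J. lam i \<le> lam k}"
      have "(\<Sum>i\<in>J. a i * u t i ^ Suc n * (u t i - exp (-1))) \<le> (\<Sum>i\<in>J. if i \<in> J' then a i else 0)"
      proof (rule sum_mono)
        fix i assume i: "i \<in> J"
        then have iI: "i \<in> I" using J by auto
        note uu = u01[OF t(1) iI] and ai = a_pos[OF iI]
        show "a i * u t i ^ Suc n * (u t i - exp (-1)) \<le> (if i \<in> J' then a i else 0)"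
        proof (cases "i \<in> J'")
          case True
          have "u t i - exp (-1) \<le> 1" using uu(2) exp_gt_zero[of "-1::real"] by linarith
          then have "u t i ^ Suc n * (u t i - exp (-1)) \<le> u t i ^ Suc n * 1"
            using uu(1) by (intro mult_left_mono) auto
          also have "\<dots> \<le> 1" using uu by (simp add: power_le_one del: power_Suc)
          finally have "a i * (u t i ^ Suc n * (u t i - exp (-1))) \<le> a i * 1"
            using ai by (intro mult_left_mono) auto
          with True show ?thesis by (simp only: mult.assoc if_True mult_1_right)
        next
          case False
          then have "lam k < lam i" using i by (auto simp: J'_def)
          then have "u t i \<le> exp (-1)"
            using lam_pos[OF k(1)] by (simp add: u_def t_def)
          with False uu ai show ?thesis by (simp add: mult_nonneg_nonpos)
        qed
      qed
      also have "\<dots> = sum a J'" using J by (simp add: sum.If_cases J'_def Int_def)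
      also have "\<dots> \<le> 2 * a k" by (rule dom[rule_format]) (use J in \<open>auto simp: J'_def\<close>)
      finally show "(\<Sum>i\<in>J. a i * u t i ^ Suc n * (u t i - exp (-1))) \<le> 2 * a k" .
    qed
    moreover have "c * p t \<le> p (real (Suc (Suc n)) * t) - exp (-1) * p (real (Suc n) * t)"
    proof -
      have "c * p t \<le> (p (real (Suc (Suc n)) * t) / p t - exp (-1) * (p (real (Suc n) * t) / p t)) * p t"
        using T0[OF t(2)] p_pos[OF t(1)] by (intro mult_right_mono) auto
      then show ?thesis using p_pos[OF t(1)] by (simp add: left_diff_distrib del: of_nat_Suc)
    qed
    ultimately show ?thesis by (simp add: t_def)
  qed
  \<comment> \<open>\<open>d\<close> is the uniform lower bound for the mass of the atoms; the factor \<open>exp (-2)\<close> bounds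
     \<open>exp (- \<theta>)\<close> from below for \<open>\<theta> \<le> 2\<close>.\<close>
  define d where "d = c / 2 * exp (-2)"
  have "d > 0" using c by (simp add: d_def)
  obtain M :: nat where M: "2 < real M * d" using reals_Archimedean3[OF \<open>d > 0\<close>] by blast
  define \<theta> where "\<theta> = (\<lambda>i::nat. 1 + real i / real M)"
  have M0: "M > 0" using M by (cases M) auto
  have \<theta>: "1 \<le> \<theta> i" "\<theta> i \<le> 2" if "i < M" for i
    using that by (simp_all add: \<theta>_def divide_le_eq)
  have "inj_on (\<lambda>i. exp (- \<theta> i)) {..<M}" using M0 by (auto simp: inj_on_def \<theta>_def)
  moreover have "0 \<le> exp (- \<theta> i) \<and> exp (- \<theta> i) \<le> 1" if "i < M" for i using \<theta>[OF that] by simp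
  ultimately obtain N where N: "\<And>v. 0 \<le> v \<Longrightarrow> v \<le> 1 \<Longrightarrow> (\<Sum>i<M. (1 - (v - exp (- \<theta> i))\<^sup>2) ^ N) \<le> 2"
    using bumps_sum_le_2[of M "\<lambda>i. exp (- \<theta> i)"] by metis
  define g where "g = (\<lambda>i. (1 - [:- exp (- \<theta> i), 1:]\<^sup>2) ^ N)"
  have poly_g: "poly (g i) v = (1 - (v - exp (- \<theta> i))\<^sup>2) ^ N" for i v
    by (simp add: g_def)
  define G where "G = (\<lambda>i t. \<Sum>j\<le>degree (g i). coeff (g i) j * p (real (Suc j) * t))"
  have G: "((\<lambda>k. a k * u t k * (1 - (u t k - exp (- \<theta> i))\<^sup>2) ^ N) has_sum G i t) I" if "t > 0" for i t
    using moments[OF that, of "g i"] by (simp add: G_def poly_g)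
  have GL: "((\<lambda>t. G i t / p t) \<longlongrightarrow> L (g i)) at_top" for i
    unfolding G_def by (rule L)
  have upper: "(\<Sum>i<M. L (g i)) \<le> 2"
  proof (rule tendsto_upperbound)
    show "((\<lambda>t. \<Sum>i<M. G i t / p t) \<longlongrightarrow> (\<Sum>i<M. L (g i))) at_top" by (intro tendsto_sum GL)
    show "\<forall>\<^sub>F t in at_top. (\<Sum>i<M. G i t / p t) \<le> 2"
      using eventually_gt_at_top[of "0::real"]
    proof eventually_elim
      case (elim t)
      have "((\<lambda>k. \<Sum>i<M. a k * u t k * (1 - (u t k - exp (- \<theta> i))\<^sup>2) ^ N) has_sum (\<Sum>i<M. G i t)) I"
        using elim by (intro has_sum_sum G) auto
      moreover have "((\<lambda>k. 2 * (a k * exp (- t * lam k))) has_sum 2 * p t) I"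
        using elim by (intro has_sum_cmult_right p)
      ultimately have "(\<Sum>i<M. G i t) \<le> 2 * p t"
      proof (rule has_sum_mono)
        fix k assume k: "k \<in> I"
        have "(a k * u t k) * (\<Sum>i<M. (1 - (u t k - exp (- \<theta> i))\<^sup>2) ^ N) \<le> (a k * u t k) * 2"
          using u01[OF elim k] a_pos[OF k] by (intro mult_left_mono N) auto
        then show "(\<Sum>i<M. a k * u t k * (1 - (u t k - exp (- \<theta> i))\<^sup>2) ^ N) \<le> 2 * (a k * exp (- t * lam k))"
          by (simp add: sum_distrib_left u_def mult_ac)
      qed
      then show ?case using p_pos[OF elim] by (simp add: sum_divide_distrib[symmetric] divide_le_eq)
    qed
  qed simp
  have lower: "d \<le> L (g i)" if i: "i < M" for i
  proof (rule ccontr)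
    assume "\<not> d \<le> L (g i)"
    then have "\<forall>\<^sub>F t in at_top. G i t / p t < d" by (intro order_tendstoD(2)[OF GL]) simp
    then obtain T1 where T1: "\<And>t. t \<ge> T1 \<Longrightarrow> G i t / p t < d"
      by (auto simp: eventually_at_top_linorder)
    define T where "T = max (max T0 T1) 1"
    have T: "T \<ge> T0" "T \<ge> T1" "T > 0" by (auto simp: T_def)
    obtain k where k: "k \<in> I" "lam k < 1 / T"
      and dom: "\<forall>J. finite J \<longrightarrow> J \<subseteq> {i \<in> I. lam i \<le> lam k} \<longrightarrow> sum a J \<le> 2 * a k"
      using atoms[of "1 / T"] T(3) by auto
    have lk: "lam k > 0" using lam_pos k by simp
    have kT: "T \<le> 1 / lam k" using k(2) lk T(3) by (simp add: field_simps)
    define t where "t = \<theta> i / lam k"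
    have le: "1 / lam k \<le> t" using \<theta>[OF i] lk by (simp add: t_def divide_right_mono)
    then have t: "t > 0" "t \<ge> T1" using kT T by simp_all
    have "u t k = exp (- \<theta> i)" using lk by (simp add: u_def t_def)
    have "0 \<le> a j * u t j * (1 - (u t j - exp (- \<theta> i))\<^sup>2) ^ N" if j: "j \<in> I" for j
    proof -
      have "0 < exp (- \<theta> i)" "exp (- \<theta> i) \<le> 1" using \<theta>[OF i] by simp_all
      with u01[OF t(1) j] have "\<bar>u t j - exp (- \<theta> i)\<bar> \<le> 1" by arith
      then have "(u t j - exp (- \<theta> i))\<^sup>2 \<le> 1" by (simp add: abs_square_le_1)
      with u01[OF t(1) j] a_pos[OF j] show ?thesis by simp
    qed
    then have "(\<Sum>j\<in>{k}. a j * u t j * (1 - (u t j - exp (- \<theta> i))\<^sup>2) ^ N) \<le> G i t"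
      using k(1) by (intro finite_sum_le_has_sum[OF G[OF t(1)]]) auto
    then have "a k * exp (- \<theta> i) \<le> G i t"
      using \<open>u t k = exp (- \<theta> i)\<close> by simp
    have "d * p t \<le> d * p (1 / lam k)"
      using \<open>d > 0\<close> lk le by (intro mult_left_mono p_antimono) auto
    also have "\<dots> = (c / 2 * p (1 / lam k)) * exp (-2)" by (simp add: d_def)
    also have "\<dots> \<le> a k * exp (- \<theta> i)"
      using big_atom[OF k(1) _ dom] kT T \<theta>[OF i] a_pos[OF k(1)] by (intro mult_mono) auto
    also have "\<dots> \<le> G i t" by fact
    also have "\<dots> < d * p t" using T1[OF t(2)] p_pos[OF t(1)] by (simp add: divide_less_eq)
    finally show False by simp
  qed
  have "real M * d \<le> (\<Sum>i<M. L (g i))"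
    using sum_mono[of "{..<M}" "\<lambda>_. d" "\<lambda>i. L (g i)"] lower by simp
  with upper M show False by simp
qed

section \<open>Square integrable functions\<close>

lemma L2_I: "f \<in> borel_measurable m \<Longrightarrow> integrable m (\<lambda>x. (f x)\<^sup>2) \<Longrightarrow> f \<in> L2 m"
  by (simp add: L2_def)

lemma L2_borel: "f \<in> L2 m \<Longrightarrow> f \<in> borel_measurable m"
  by (simp add: L2_def)

lemma L2_integrable_sq: "f \<in> L2 m \<Longrightarrow> integrable m (\<lambda>x. (f x)\<^sup>2)"
  by (simp add: L2_def)

lemma L2_integrable_prod:
  assumes "f \<in> L2 m" "g \<in> L2 m"
  shows "integrable m (\<lambda>x. f x * g x)"
proof (rule Bochner_Integration.integrable_bound)
  show "integrable m (\<lambda>x. (f x)\<^sup>2 + (g x)\<^sup>2)" using assms by (simp add: L2_def)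
  show "(\<lambda>x. f x * g x) \<in> borel_measurable m" using assms by (auto simp: L2_def)
  show "AE x in m. norm (f x * g x) \<le> norm ((f x)\<^sup>2 + (g x)\<^sup>2)"
  proof (rule AE_I2)
    fix x
    have "0 \<le> (\<bar>f x\<bar> - \<bar>g x\<bar>)\<^sup>2" by simp
    then have "2 * \<bar>f x * g x\<bar> \<le> (f x)\<^sup>2 + (g x)\<^sup>2"
      by (simp add: power2_diff abs_mult)
    moreover have "0 \<le> \<bar>f x * g x\<bar>" by simp
    ultimately show "norm (f x * g x) \<le> norm ((f x)\<^sup>2 + (g x)\<^sup>2)"
      unfolding real_norm_def by linarith
  qed
qed

lemma L2_lincomb:
  assumes "f \<in> L2 m" "g \<in> L2 m"
  shows "(\<lambda>x. a * f x + b * g x) \<in> L2 m"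
proof (rule L2_I)
  show "(\<lambda>x. a * f x + b * g x) \<in> borel_measurable m" using assms by (auto simp: L2_def)
  have "integrable m (\<lambda>x. a\<^sup>2 * (f x)\<^sup>2 + 2 * a * b * (f x * g x) + b\<^sup>2 * (g x)\<^sup>2)"
    using assms by (intro Bochner_Integration.integrable_add integrable_mult_right L2_integrable_prod L2_integrable_sq)
  moreover have "(\<lambda>x. (a * f x + b * g x)\<^sup>2) = (\<lambda>x. a\<^sup>2 * (f x)\<^sup>2 + 2 * a * b * (f x * g x) + b\<^sup>2 * (g x)\<^sup>2)"
    by (auto simp: power2_eq_square algebra_simps)
  ultimately show "integrable m (\<lambda>x. (a * f x + b * g x)\<^sup>2)" by simp
qed

lemma L2_add: "f \<in> L2 m \<Longrightarrow> g \<in> L2 m \<Longrightarrow> (\<lambda>x. f x + g x) \<in> L2 m"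
  using L2_lincomb[of f m g 1 1] by simp

lemma L2_diff: "f \<in> L2 m \<Longrightarrow> g \<in> L2 m \<Longrightarrow> (\<lambda>x. f x - g x) \<in> L2 m"
  using L2_lincomb[of f m g 1 "-1"] by simp

lemma L2_cmult: "f \<in> L2 m \<Longrightarrow> (\<lambda>x. a * f x) \<in> L2 m"
  using L2_lincomb[of f m f a 0] by simp

lemma L2_zero: "(\<lambda>x. 0) \<in> L2 m"
  by (simp add: L2_def)

lemma L2_norm_nonneg: "0 \<le> L2_norm m f"
  by (simp add: L2_norm_def L2_inner_def)

lemma L2_norm_sq: "(L2_norm m f)\<^sup>2 = (LINT x|m. (f x)\<^sup>2)"
  by (simp add: L2_norm_def L2_inner_def power2_eq_square)

lemma L2_norm_cong_AE:
  assumes "f \<in> borel_measurable m" "g \<in> borel_measurable m" "AE x in m. f x = g x"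
  shows "L2_norm m f = L2_norm m g"
  unfolding L2_norm_def L2_inner_def
  by (intro arg_cong[of _ _ sqrt] integral_cong_AE) (use assms in auto)

lemma L2_inner_cong_AE:
  assumes "f \<in> borel_measurable m" "g \<in> borel_measurable m" "h \<in> borel_measurable m" "AE x in m. f x = g x"
  shows "L2_inner m f h = L2_inner m g h"
  unfolding L2_inner_def by (intro integral_cong_AE) (use assms in auto)

lemma L2_norm_cmult: "L2_norm m (\<lambda>x. a * f x) = \<bar>a\<bar> * L2_norm m f"
proof -
  have "(LINT x|m. a * f x * (a * f x)) = a\<^sup>2 * (LINT x|m. f x * f x)"
    unfolding integral_mult_right_zero[symmetric] by (simp add: power2_eq_square mult_ac)
  then show ?thesis by (simp add: L2_norm_def L2_inner_def real_sqrt_mult)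
qed

lemma L2_inner_add_left:
  "f \<in> L2 m \<Longrightarrow> g \<in> L2 m \<Longrightarrow> h \<in> L2 m \<Longrightarrow> L2_inner m (\<lambda>x. f x + g x) h = L2_inner m f h + L2_inner m g h"
  by (simp add: L2_inner_def ring_distribs L2_integrable_prod)

lemma L2_inner_cmult_left: "L2_inner m (\<lambda>x. a * f x) h = a * L2_inner m f h"
  by (simp add: L2_inner_def mult.assoc)

lemma L2_Cauchy_Schwarz:
  assumes f: "f \<in> L2 m" and g: "g \<in> L2 m"
  shows "\<bar>L2_inner m f g\<bar> \<le> L2_norm m f * L2_norm m g"
proof -
  define A B c where "A = L2_norm m f" and "B = L2_norm m g" and "c = L2_inner m f g"
  have quad: "0 \<le> s\<^sup>2 * A\<^sup>2 + 2 * s * r * c + r\<^sup>2 * B\<^sup>2" for s r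
  proof -
    have "0 \<le> (LINT x|m. (s * f x + r * g x)\<^sup>2)" by simp
    also have "(\<lambda>x. (s * f x + r * g x)\<^sup>2) = (\<lambda>x. s\<^sup>2 * (f x)\<^sup>2 + 2 * s * r * (f x * g x) + r\<^sup>2 * (g x)\<^sup>2)"
      by (auto simp: power2_eq_square algebra_simps)
    also have "(LINT x|m. \<dots> x) = s\<^sup>2 * A\<^sup>2 + 2 * s * r * c + r\<^sup>2 * B\<^sup>2"
      using f g by (simp add: L2_integrable_prod L2_integrable_sq A_def B_def c_def L2_norm_sq L2_inner_def)
    finally show ?thesis .
  qed
  have AB: "0 \<le> A" "0 \<le> B" by (simp_all add: A_def B_def L2_norm_nonneg)
  have "c\<^sup>2 \<le> A\<^sup>2 * B\<^sup>2"
  proof (cases "A = 0")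
    case True
    have "c = 0"
    proof (rule ccontr)
      assume "c \<noteq> 0"
      have "0 \<le> 2 * (- (B\<^sup>2 + 1) / (2 * c)) * 1 * c + 1\<^sup>2 * B\<^sup>2"
        using quad[of "- (B\<^sup>2 + 1) / (2 * c)" 1] True by simp
      also have "\<dots> = -1" using \<open>c \<noteq> 0\<close> by (simp add: field_simps)
      finally show False by simp
    qed
    then show ?thesis by simp
  next
    case False
    have "0 \<le> c\<^sup>2 * A\<^sup>2 + 2 * c * (- A\<^sup>2) * c + (- A\<^sup>2)\<^sup>2 * B\<^sup>2" by (rule quad)
    also have "\<dots> = A\<^sup>2 * (A\<^sup>2 * B\<^sup>2 - c\<^sup>2)" by (simp add: power2_eq_square algebra_simps)
    finally show ?thesis using False by (simp add: zero_le_mult_iff)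
  qed
  then have "\<bar>c\<bar>\<^sup>2 \<le> (A * B)\<^sup>2" by (simp add: power_mult_distrib)
  then show ?thesis
    using AB unfolding A_def B_def c_def by (meson power2_le_imp_le mult_nonneg_nonneg)
qed

lemma L2_norm_triangle:
  assumes f: "f \<in> L2 m" and g: "g \<in> L2 m"
  shows "L2_norm m (\<lambda>x. f x + g x) \<le> L2_norm m f + L2_norm m g"
proof (rule power2_le_imp_le)
  have "(\<lambda>x. (f x + g x)\<^sup>2) = (\<lambda>x. (f x)\<^sup>2 + 2 * (f x * g x) + (g x)\<^sup>2)"
    by (auto simp: power2_eq_square algebra_simps)
  then have "(L2_norm m (\<lambda>x. f x + g x))\<^sup>2 = (L2_norm m f)\<^sup>2 + 2 * L2_inner m f g + (L2_norm m g)\<^sup>2"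
    using f g unfolding L2_norm_sq by (simp add: L2_integrable_prod L2_integrable_sq L2_inner_def)
  also have "\<dots> \<le> (L2_norm m f + L2_norm m g)\<^sup>2"
    using L2_Cauchy_Schwarz[OF f g] by (simp add: power2_sum)
  finally show "(L2_norm m (\<lambda>x. f x + g x))\<^sup>2 \<le> (L2_norm m f + L2_norm m g)\<^sup>2" .
qed (simp add: L2_norm_nonneg)

lemma L2_norm_zeroD:
  assumes f: "f \<in> L2 m" and 0: "L2_norm m f = 0"
  shows "AE x in m. f x = 0"
proof -
  have "(LINT x|m. (f x)\<^sup>2) = 0" using 0 L2_norm_sq[of m f] by simp
  then show ?thesis
    using integral_nonneg_eq_0_iff_AE[OF L2_integrable_sq[OF f]] by simp
qed

text \<open>The Cauchy-Schwarz inequality for \<open>\<Sum>n. sqrt (c n) * (sqrt (c n) * \<bar>u n\<bar>)\<close>.\<close>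
lemma sq_suminf_le:
  fixes c u :: "nat \<Rightarrow> real"
  assumes c: "\<And>n. 0 \<le> c n" "summable c" and cu: "summable (\<lambda>n. c n * (u n)\<^sup>2)"
  shows "summable (\<lambda>n. c n * \<bar>u n\<bar>)" "(\<Sum>n. c n * \<bar>u n\<bar>)\<^sup>2 \<le> suminf c * (\<Sum>n. c n * (u n)\<^sup>2)"
proof -
  show s: "summable (\<lambda>n. c n * \<bar>u n\<bar>)"
  proof (rule summable_comparison_test'[OF summable_add[OF c(2) cu]])
    fix n
    have "0 \<le> (\<bar>u n\<bar> - 1)\<^sup>2 + (u n)\<^sup>2 + 1" by simp
    then have "\<bar>u n\<bar> \<le> 1 + (u n)\<^sup>2" by (simp add: power2_diff)
    from mult_left_mono[OF this c(1)[of n]]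
    show "norm (c n * \<bar>u n\<bar>) \<le> c n + c n * (u n)\<^sup>2"
      using c(1)[of n] by (simp add: abs_mult algebra_simps)
  qed
  show "(\<Sum>n. c n * \<bar>u n\<bar>)\<^sup>2 \<le> suminf c * (\<Sum>n. c n * (u n)\<^sup>2)"
  proof (rule LIMSEQ_le)
    show "(\<lambda>N. (\<Sum>n<N. c n * \<bar>u n\<bar>)\<^sup>2) \<longlonglongrightarrow> (\<Sum>n. c n * \<bar>u n\<bar>)\<^sup>2"
      by (intro tendsto_power summable_LIMSEQ s)
    show "(\<lambda>N. (\<Sum>n<N. c n) * (\<Sum>n<N. c n * (u n)\<^sup>2)) \<longlonglongrightarrow> suminf c * (\<Sum>n. c n * (u n)\<^sup>2)"
      by (intro tendsto_mult summable_LIMSEQ c cu)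
    have "(\<Sum>n<N. c n * \<bar>u n\<bar>)\<^sup>2 \<le> (\<Sum>n<N. c n) * (\<Sum>n<N. c n * (u n)\<^sup>2)" for N
    proof -
      have "(\<Sum>n<N. sqrt (c n) * (sqrt (c n) * \<bar>u n\<bar>))\<^sup>2
          \<le> (\<Sum>n<N. (sqrt (c n))\<^sup>2) * (\<Sum>n<N. (sqrt (c n) * \<bar>u n\<bar>)\<^sup>2)"
        by (rule Cauchy_Schwarz_ineq_sum)
      then show ?thesis using c(1) by (simp add: power_mult_distrib mult.assoc[symmetric])
    qed
    then show "\<exists>N0. \<forall>N\<ge>N0. (\<Sum>n<N. c n * \<bar>u n\<bar>)\<^sup>2 \<le> (\<Sum>n<N. c n) * (\<Sum>n<N. c n * (u n)\<^sup>2)"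
      by blast
  qed
qed

text \<open>The form of completeness of \<open>L\<^sup>2\<close> that is used below.  The pointwise bound
\<open>(\<Sum>n. c n * \<bar>u n x\<bar>)\<^sup>2 \<le> (\<Sum>n. c n) * (\<Sum>n. c n * (u n x)\<^sup>2)\<close> reduces it to the interchange of sum and
integral for nonnegative functions.\<close>
lemma L2_series_bound:
  fixes c :: "nat \<Rightarrow> real" and u :: "nat \<Rightarrow> 'a \<Rightarrow> real"
  assumes c: "\<And>n. 0 \<le> c n" "summable c" and u: "\<And>n. u n \<in> L2 m" "\<And>n. L2_norm m (u n) \<le> 1"
    and e: "\<And>n. \<bar>e n\<bar> = c n"
  shows "AE x in m. summable (\<lambda>n. e n * u n x)"
    and "(\<lambda>x. \<Sum>n. e n * u n x) \<in> L2 m"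
    and "L2_norm m (\<lambda>x. \<Sum>n. e n * u n x) \<le> suminf c"
proof -
  have meas [measurable]: "\<And>n. u n \<in> borel_measurable m" using u by (simp add: L2_def)
  have int: "integrable m (\<lambda>x. c n * (u n x)\<^sup>2)" for n
    by (intro integrable_mult_right L2_integrable_sq u)
  have le: "(LINT x|m. c n * (u n x)\<^sup>2) \<le> c n" for n
  proof -
    have "(L2_norm m (u n))\<^sup>2 \<le> 1" using u(2) by (simp add: L2_norm_nonneg power_le_one)
    then show ?thesis using c(1)[of n] by (simp add: L2_norm_sq mult_left_le)
  qed
  have nn: "(\<integral>\<^sup>+x. ennreal (c n * (u n x)\<^sup>2) \<partial>m) \<le> ennreal (c n)" for n
    using le by (subst nn_integral_eq_integral[OF int]) (auto simp: c intro: ennreal_leI)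
  have "(\<integral>\<^sup>+x. (\<Sum>n. ennreal (c n * (u n x)\<^sup>2)) \<partial>m) = (\<Sum>n. \<integral>\<^sup>+x. ennreal (c n * (u n x)\<^sup>2) \<partial>m)"
    by (rule nn_integral_suminf) simp
  also have "\<dots> \<le> (\<Sum>n. ennreal (c n))" by (intro suminf_le nn summableI)
  also have "\<dots> = ennreal (suminf c)" by (rule suminf_ennreal2[OF c])
  finally have total: "(\<integral>\<^sup>+x. (\<Sum>n. ennreal (c n * (u n x)\<^sup>2)) \<partial>m) \<le> ennreal (suminf c)" .
  then have "(\<integral>\<^sup>+x. (\<Sum>n. ennreal (c n * (u n x)\<^sup>2)) \<partial>m) \<noteq> \<infinity>"
    by (auto simp: top_unique)
  then have "AE x in m. (\<Sum>n. ennreal (c n * (u n x)\<^sup>2)) \<noteq> \<infinity>"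
    by (intro nn_integral_PInf_AE) auto
  then have AEs: "AE x in m. summable (\<lambda>n. c n * (u n x)\<^sup>2)"
    by eventually_elim (intro summable_suminf_not_top, auto simp: c)
  have s_abs: "summable (\<lambda>n. \<bar>e n * u n x\<bar>)" if "summable (\<lambda>n. c n * (u n x)\<^sup>2)" for x
    using sq_suminf_le(1)[OF c that] by (simp add: abs_mult e)
  show "AE x in m. summable (\<lambda>n. e n * u n x)"
    using AEs by eventually_elim (rule summable_rabs_cancel, rule s_abs)
  have sqle: "(\<Sum>n. e n * u n x)\<^sup>2 \<le> suminf c * (\<Sum>n. c n * (u n x)\<^sup>2)"
    if "summable (\<lambda>n. c n * (u n x)\<^sup>2)" for x
  proof -
    have "\<bar>\<Sum>n. e n * u n x\<bar> \<le> (\<Sum>n. c n * \<bar>u n x\<bar>)"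
      using summable_rabs[OF s_abs[OF that]] by (simp add: abs_mult e)
    then have "\<bar>\<Sum>n. e n * u n x\<bar>\<^sup>2 \<le> (\<Sum>n. c n * \<bar>u n x\<bar>)\<^sup>2" by (intro power_mono) auto
    with sq_suminf_le(2)[OF c that] show ?thesis by simp
  qed
  have F [measurable]: "(\<lambda>x. \<Sum>n. e n * u n x) \<in> borel_measurable m" by measurable
  have "(\<integral>\<^sup>+x. ennreal ((\<Sum>n. e n * u n x)\<^sup>2) \<partial>m)
      \<le> (\<integral>\<^sup>+x. ennreal (suminf c) * (\<Sum>n. ennreal (c n * (u n x)\<^sup>2)) \<partial>m)"
  proof (rule nn_integral_mono_AE)
    show "AE x in m. ennreal ((\<Sum>n. e n * u n x)\<^sup>2) \<le> ennreal (suminf c) * (\<Sum>n. ennreal (c n * (u n x)\<^sup>2))"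
      using AEs
    proof eventually_elim
      case (elim x)
      have "(\<Sum>n. ennreal (c n * (u n x)\<^sup>2)) = ennreal (\<Sum>n. c n * (u n x)\<^sup>2)"
        using elim c by (intro suminf_ennreal2) auto
      with sqle[OF elim] show ?case
        by (simp add: ennreal_mult'[symmetric] suminf_nonneg c ennreal_leI)
    qed
  qed
  also have "\<dots> = ennreal (suminf c) * (\<integral>\<^sup>+x. (\<Sum>n. ennreal (c n * (u n x)\<^sup>2)) \<partial>m)"
    by (rule nn_integral_cmult) measurable
  also have "\<dots> \<le> ennreal (suminf c) * ennreal (suminf c)"
    by (intro mult_left_mono total) simp
  also have "\<dots> = ennreal ((suminf c)\<^sup>2)"
    by (simp add: power2_eq_square ennreal_mult suminf_nonneg c)
  finally have fin: "(\<integral>\<^sup>+x. ennreal ((\<Sum>n. e n * u n x)\<^sup>2) \<partial>m) \<le> ennreal ((suminf c)\<^sup>2)" .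
  have int: "integrable m (\<lambda>x. (\<Sum>n. e n * u n x)\<^sup>2)"
    using fin by (intro integrableI_nonneg) (auto intro: le_less_trans)
  show "(\<lambda>x. \<Sum>n. e n * u n x) \<in> L2 m" by (rule L2_I[OF F int])
  have "ennreal (LINT x|m. (\<Sum>n. e n * u n x)\<^sup>2) \<le> ennreal ((suminf c)\<^sup>2)"
    using fin nn_integral_eq_integral[OF int] by simp
  then have "(L2_norm m (\<lambda>x. \<Sum>n. e n * u n x))\<^sup>2 \<le> (suminf c)\<^sup>2"
    unfolding L2_norm_sq by (subst (asm) ennreal_le_iff) auto
  then show "L2_norm m (\<lambda>x. \<Sum>n. e n * u n x) \<le> suminf c"
    by (rule power2_le_imp_le) (simp add: suminf_nonneg c)
qed

section \<open>Semigroups acting on eigenvectors\<close>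

text \<open>The Banach-Steinhaus theorem for seminorms on \<open>L\<^sup>2\<close>, by Sokal's argument without the Baire category
theorem.  For every \<open>G\<close>, one of \<open>q (G + h)\<close> and \<open>q (G - h)\<close> is at least \<open>q h\<close>, because \<open>h\<close> is half
the difference of \<open>G + h\<close> and \<open>G - h\<close>.  If the norms \<open>Q n\<close> of the seminorms are unbounded, choose
nearly norming vectors \<open>u k\<close> for seminorms whose norms grow fast, and signs such that the \<open>k\<close>-th
partial sum of \<open>F = \<Sum>k. \<plusminus> 3 ^ - k * u k\<close> is large for the \<open>k\<close>-th seminorm.  The tail of the series
is too small to compensate, so the seminorms of \<open>F\<close> are unbounded.\<close>
lemma L2_uniform_boundedness:
  fixes q :: "nat \<Rightarrow> ('a \<Rightarrow> real) \<Rightarrow> real"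
  assumes nonneg: "\<And>n f. f \<in> L2 m \<Longrightarrow> 0 \<le> q n f"
    and sublin: "\<And>n a b f g. f \<in> L2 m \<Longrightarrow> g \<in> L2 m \<Longrightarrow>
        q n (\<lambda>x. a * f x + b * g x) \<le> \<bar>a\<bar> * q n f + \<bar>b\<bar> * q n g"
    and bounded: "\<And>n. \<exists>K. \<forall>f\<in>L2 m. q n f \<le> K * L2_norm m f"
    and pointwise: "\<And>f. f \<in> L2 m \<Longrightarrow> Bseq (\<lambda>n. q n f)"
  shows "\<exists>K. \<forall>n. \<forall>f\<in>L2 m. q n f \<le> K * L2_norm m f"
proof (rule ccontr)
  assume unbounded: "\<not> ?thesis"
  define B where "B = (\<lambda>n. {q n f |f. f \<in> L2 m \<and> L2_norm m f \<le> 1})"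
  define Q where "Q = (\<lambda>n. Sup (B n))"
  have bdd: "bdd_above (B n)" for n
  proof -
    obtain K where K: "\<And>f. f \<in> L2 m \<Longrightarrow> q n f \<le> K * L2_norm m f" using bounded by blast
    have "q n f \<le> \<bar>K\<bar>" if "f \<in> L2 m" "L2_norm m f \<le> 1" for f
    proof -
      have "q n f \<le> \<bar>K\<bar> * L2_norm m f"
        using K[OF that(1)] by (smt (verit) L2_norm_nonneg mult_right_mono)
      also have "\<dots> \<le> \<bar>K\<bar> * 1" using that(2) by (intro mult_left_mono) auto
      finally show ?thesis by simp
    qed
    then show ?thesis unfolding B_def by (intro bdd_aboveI[of _ "\<bar>K\<bar>"]) auto
  qed
  have Q: "q n f \<le> Q n * L2_norm m f" if f: "f \<in> L2 m" for n f
  proof (cases "L2_norm m f = 0")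
    case True
    obtain K where "q n f \<le> K * L2_norm m f" using bounded f by blast
    with True show ?thesis by simp
  next
    case False
    define r where "r = L2_norm m f"
    have r: "r > 0" using False L2_norm_nonneg[of m f] by (simp add: r_def)
    have g: "(\<lambda>x. (1 / r) * f x) \<in> L2 m" by (rule L2_cmult[OF f])
    have "L2_norm m (\<lambda>x. (1 / r) * f x) = 1"
      using r by (subst L2_norm_cmult) (simp add: r_def[symmetric])
    then have "q n (\<lambda>x. (1 / r) * f x) \<le> Q n"
      unfolding Q_def by (intro cSup_upper bdd) (use g in \<open>auto simp: B_def\<close>)
    moreover have "q n f \<le> r * q n (\<lambda>x. (1 / r) * f x)"
      using sublin[OF g g, of n r 0] r by simp
    ultimately have "q n f \<le> r * Q n"
      using r by (meson mult_left_mono less_imp_le order_trans)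
    then show ?thesis by (simp add: r_def mult.commute)
  qed
  \<comment> \<open>With ratio \<open>1 / 3\<close> the terms after the \<open>k\<close>-th one add up to \<open>c k / 2\<close>, which is less than the
     share \<open>2 / 3 * c k\<close> that the \<open>k\<close>-th term secures.\<close>
  define c where "c = (\<lambda>k::nat. (1 / 3 :: real) ^ k)"
  have c: "0 < c k" for k by (simp add: c_def)
  have c_sums: "(\<lambda>k. c (k + n)) sums (3 / 2 * c n)" for n
    using sums_mult2[OF geometric_sums[of "1 / 3 :: real"], of "c n"] by (simp add: c_def power_add)
  have "\<exists>n u. 6 * real k / c k < Q n \<and> u \<in> L2 m \<and> L2_norm m u \<le> 1 \<and> 2 / 3 * Q n < q n u" for k
  proof -
    have "\<exists>n. 6 * real k / c k < Q n"
    proof (rule ccontr)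
      assume "\<not> ?thesis"
      then have "Q n \<le> 6 * real k / c k" for n by (simp add: not_less)
      then have "q n f \<le> 6 * real k / c k * L2_norm m f" if "f \<in> L2 m" for n f
        using Q[OF that, of n] by (meson L2_norm_nonneg mult_right_mono order_trans)
      then show False using unbounded by blast
    qed
    then obtain n where n: "6 * real k / c k < Q n" by blast
    moreover have "0 \<le> 6 * real k / c k" using c[of k] by simp
    ultimately have "2 / 3 * Q n < Q n" by simp
    moreover have "q n (\<lambda>x. 0) \<in> B n"
      using L2_norm_cmult[of m 0 "\<lambda>x. 0"] by (auto simp: B_def intro!: L2_zero)
    ultimately obtain y where "y \<in> B n" "2 / 3 * Q n < y"
      unfolding Q_def using less_cSup_iff[OF _ bdd[of n]] by blast
    with n show ?thesis by (auto simp: B_def)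
  qed
  then obtain r u where ru: "\<And>k. 6 * real k / c k < Q (r k)" "\<And>k. u k \<in> L2 m"
      "\<And>k. L2_norm m (u k) \<le> 1" "\<And>k. 2 / 3 * Q (r k) < q (r k) (u k)"
    by metis
  \<comment> \<open>The sign that makes the seminorm with index \<open>r k\<close> of the next partial sum large.\<close>
  define sg where "sg = (\<lambda>k G. if q (r k) (u k) * c k \<le> q (r k) (\<lambda>x. G x + c k * u k x) then 1 else -1 :: real)"
  define S where "S = rec_nat (\<lambda>x. 0) (\<lambda>k G. \<lambda>x. G x + sg k G * c k * u k x)"
  define e where "e = (\<lambda>k. sg k (S k) * c k)"
  have S0: "S 0 = (\<lambda>x. 0)" and SSuc: "S (Suc k) = (\<lambda>x. S k x + e k * u k x)" for k
    by (simp_all add: S_def e_def)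
  have S_sum: "S n x = (\<Sum>k<n. e k * u k x)" for n x
    by (induction n) (simp_all add: S0 SSuc)
  have S_L2: "S n \<in> L2 m" for n
    by (induction n) (simp_all add: S0 SSuc L2_zero L2_add[OF _ L2_cmult[OF ru(2)]])
  have e: "\<bar>e k\<bar> = c k" for k using c[of k] by (simp add: e_def sg_def)
  have S_big: "q (r k) (u k) * c k \<le> q (r k) (S (Suc k))" for k
  proof (cases "q (r k) (u k) * c k \<le> q (r k) (\<lambda>x. S k x + c k * u k x)")
    case True
    then show ?thesis by (simp add: SSuc e_def sg_def)
  next
    case False
    then have S: "S (Suc k) = (\<lambda>x. S k x - c k * u k x)" by (simp add: SSuc e_def sg_def)
    have "(\<lambda>x. (1 / (2 * c k)) * (S k x + c k * u k x) + (- (1 / (2 * c k))) * (S k x - c k * u k x)) = u k"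
      using c[of k] by (auto simp: field_simps)
    moreover have "q (r k) (\<lambda>x. (1 / (2 * c k)) * (S k x + c k * u k x) + (- (1 / (2 * c k))) * (S k x - c k * u k x))
        \<le> \<bar>1 / (2 * c k)\<bar> * q (r k) (\<lambda>x. S k x + c k * u k x) + \<bar>- (1 / (2 * c k))\<bar> * q (r k) (\<lambda>x. S k x - c k * u k x)"
      by (rule sublin) (intro L2_add L2_diff L2_cmult S_L2 ru)+
    ultimately have "q (r k) (u k) * c k \<le> (q (r k) (\<lambda>x. S k x + c k * u k x) + q (r k) (S (Suc k))) / 2"
      using c[of k] by (simp add: S field_simps)
    with False show ?thesis by simp
  qed
  define F where "F = (\<lambda>x. \<Sum>k. e k * u k x)"
  have csum: "summable (\<lambda>k. c (k + n))" "(\<Sum>k. c (k + n)) = 3 / 2 * c n" for n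
    using c_sums[of n] by (simp_all add: sums_iff)
  have tail: "AE x in m. summable (\<lambda>k. e (k + n) * u (k + n) x)"
    "(\<lambda>x. \<Sum>k. e (k + n) * u (k + n) x) \<in> L2 m"
    "L2_norm m (\<lambda>x. \<Sum>k. e (k + n) * u (k + n) x) \<le> 3 / 2 * c n" for n
    using L2_series_bound[of "\<lambda>k. c (k + n)" "\<lambda>k. u (k + n)" m "\<lambda>k. e (k + n)"]
    using csum(1)[of 0] by (simp_all add: csum ru e less_imp_le c)
  have F: "F \<in> L2 m" using tail(2)[of 0] by (simp add: F_def)
  have FS: "L2_norm m (\<lambda>x. F x - S n x) \<le> 3 / 2 * c n" for n
  proof -
    have "AE x in m. F x - S n x = (\<Sum>k. e (k + n) * u (k + n) x)"
      using tail(1)[of n]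
    proof eventually_elim
      case (elim x)
      then have "summable (\<lambda>k. e k * u k x)" by (subst (asm) summable_iff_shift)
      from suminf_split_initial_segment[OF this, of n] show ?case
        by (simp add: F_def S_sum)
    qed
    then have "L2_norm m (\<lambda>x. F x - S n x) = L2_norm m (\<lambda>x. \<Sum>k. e (k + n) * u (k + n) x)"
      by (intro L2_norm_cong_AE L2_borel L2_diff F S_L2 tail(2))
    with tail(3)[of n] show ?thesis by simp
  qed
  have "real k \<le> q (r k) F" for k
  proof -
    have Qk: "Q (r k) > 0"
      using ru(1)[of k] c[of k] by (smt (verit) divide_nonneg_pos of_nat_0_le_iff)
    have "q (r k) (\<lambda>x. 1 * F x + (- 1) * (F x - S (Suc k) x))
        \<le> \<bar>1\<bar> * q (r k) F + \<bar>- 1\<bar> * q (r k) (\<lambda>x. F x - S (Suc k) x)"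
      by (intro sublin F L2_diff S_L2)
    then have "q (r k) (S (Suc k)) \<le> q (r k) F + q (r k) (\<lambda>x. F x - S (Suc k) x)" by simp
    also have "q (r k) (\<lambda>x. F x - S (Suc k) x) \<le> Q (r k) * L2_norm m (\<lambda>x. F x - S (Suc k) x)"
      by (intro Q L2_diff F S_L2)
    also have "\<dots> \<le> Q (r k) * (3 / 2 * c (Suc k))" using Qk FS by (intro mult_left_mono) auto
    also have "\<dots> = Q (r k) * c k / 2" by (simp add: c_def)
    finally have 1: "q (r k) (S (Suc k)) \<le> q (r k) F + Q (r k) * c k / 2" by simp
    have "2 / 3 * Q (r k) * c k \<le> q (r k) (u k) * c k"
      using ru(4)[of k] c[of k] by (intro mult_right_mono) auto
    also note S_big[of k]
    also note 1
    finally have "Q (r k) * c k / 6 \<le> q (r k) F" by simp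
    moreover have "real k < Q (r k) * c k / 6" using ru(1)[of k] c[of k] by (simp add: field_simps)
    ultimately show ?thesis by simp
  qed
  moreover obtain K where "\<forall>n. norm (q n F) \<le> K" using pointwise[OF F] by (rule BseqE)
  ultimately have "real k \<le> K" for k by (smt (verit) real_norm_def)
  then show False using reals_Archimedean2[of K] by (meson not_less)
qed

lemma
  assumes sg: "semigroup_generated_by_minus m A P"
  shows semigroup_L2: "0 \<le> t \<Longrightarrow> f \<in> L2 m \<Longrightarrow> P t f \<in> L2 m"
    and semigroup_linear: "0 \<le> t \<Longrightarrow> f \<in> L2 m \<Longrightarrow> g \<in> L2 m \<Longrightarrow>
        AE x in m. P t (\<lambda>y. a * f y + b * g y) x = a * P t f x + b * P t g x"
    and semigroup_bounded: "0 \<le> t \<Longrightarrow> \<exists>K. \<forall>f\<in>L2 m. L2_norm m (P t f) \<le> K * L2_norm m f"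
    and semigroup_0: "f \<in> L2 m \<Longrightarrow> AE x in m. P 0 f x = f x"
    and semigroup_add: "0 \<le> s \<Longrightarrow> 0 \<le> t \<Longrightarrow> f \<in> L2 m \<Longrightarrow> AE x in m. P (s + t) f x = P s (P t f) x"
    and semigroup_right_continuous:
      "f \<in> L2 m \<Longrightarrow> ((\<lambda>t. L2_norm m (\<lambda>x. P t f x - f x)) \<longlongrightarrow> 0) (at_right 0)"
    and semigroup_generator: "f \<in> L2 m \<Longrightarrow> g \<in> L2 m \<Longrightarrow> (f, g) \<in> A \<Longrightarrow>
        ((\<lambda>t. L2_norm m (\<lambda>x. (P t f x - f x) / t - (- g x))) \<longlongrightarrow> 0) (at_right 0)"
proof -
  note sg' = sg[unfolded semigroup_generated_by_minus_def]
  show "0 \<le> t \<Longrightarrow> f \<in> L2 m \<Longrightarrow> P t f \<in> L2 m"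
    using sg'[THEN conjunct1] by blast
  show "0 \<le> t \<Longrightarrow> f \<in> L2 m \<Longrightarrow> g \<in> L2 m \<Longrightarrow>
        AE x in m. P t (\<lambda>y. a * f y + b * g y) x = a * P t f x + b * P t g x"
    using sg'[THEN conjunct2, THEN conjunct1] by blast
  show "0 \<le> t \<Longrightarrow> \<exists>K. \<forall>f\<in>L2 m. L2_norm m (P t f) \<le> K * L2_norm m f"
    using sg'[THEN conjunct2, THEN conjunct2, THEN conjunct1] by blast
  show "f \<in> L2 m \<Longrightarrow> AE x in m. P 0 f x = f x"
    using sg'[THEN conjunct2, THEN conjunct2, THEN conjunct2, THEN conjunct1] by blast
  show "0 \<le> s \<Longrightarrow> 0 \<le> t \<Longrightarrow> f \<in> L2 m \<Longrightarrow> AE x in m. P (s + t) f x = P s (P t f) x"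
    using sg'[THEN conjunct2, THEN conjunct2, THEN conjunct2, THEN conjunct2, THEN conjunct1] by blast
  note rest = sg'[THEN conjunct2, THEN conjunct2, THEN conjunct2, THEN conjunct2, THEN conjunct2]
  show "f \<in> L2 m \<Longrightarrow> ((\<lambda>t. L2_norm m (\<lambda>x. P t f x - f x)) \<longlongrightarrow> 0) (at_right 0)"
    by (rule rest[THEN conjunct1, rule_format])
  show "f \<in> L2 m \<Longrightarrow> g \<in> L2 m \<Longrightarrow> (f, g) \<in> A \<Longrightarrow>
        ((\<lambda>t. L2_norm m (\<lambda>x. (P t f x - f x) / t - (- g x))) \<longlongrightarrow> 0) (at_right 0)"
    by (rule rest[THEN conjunct2, THEN bspec, THEN bspec, THEN iffD1])
qed

text \<open>Strong continuity at \<open>0\<close> makes \<open>P (s n) g\<close> bounded for each \<open>g\<close> along every sequence \<open>s n \<rightarrow> 0\<close>, so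
the operator norms cannot be unbounded along such a sequence.\<close>
lemma semigroup_locally_bounded:
  assumes sg: "semigroup_generated_by_minus m A P"
  shows "\<exists>\<delta>>0. \<exists>K. \<forall>s\<in>{0..\<delta>}. \<forall>f\<in>L2 m. L2_norm m (P s f) \<le> K * L2_norm m f"
proof (rule ccontr)
  note L2P = semigroup_L2[OF sg] and lin = semigroup_linear[OF sg] and bnd = semigroup_bounded[OF sg]
    and P0 = semigroup_0[OF sg] and cont = semigroup_right_continuous[OF sg]
  assume not: "\<not> ?thesis"
  have "\<exists>s f. 0 \<le> s \<and> s \<le> 1 / real (Suc n) \<and> f \<in> L2 m \<and> real n * L2_norm m f < L2_norm m (P s f)" for n
  proof -
    have "1 / real (Suc n) > 0" by simp
    with not have "\<not> (\<forall>s\<in>{0..1 / real (Suc n)}. \<forall>f\<in>L2 m. L2_norm m (P s f) \<le> real n * L2_norm m f)"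
      by blast
    then show ?thesis by (auto simp: not_le)
  qed
  then obtain s f where s: "\<And>n. 0 \<le> s n" "\<And>n. s n \<le> 1 / real (Suc n)" and f: "\<And>n. f n \<in> L2 m"
      and sf: "\<And>n. real n * L2_norm m (f n) < L2_norm m (P (s n) (f n))"
    by metis
  have s0: "s \<longlonglongrightarrow> 0"
    by (rule tendsto_sandwich[OF _ _ tendsto_const LIMSEQ_Suc[OF lim_inverse_n', unfolded inverse_eq_divide]])
      (use s in auto)
  have "\<exists>K. \<forall>n. \<forall>g\<in>L2 m. L2_norm m (P (s n) g) \<le> K * L2_norm m g"
  proof (rule L2_uniform_boundedness)
    fix n a b and g h :: "'a \<Rightarrow> real" assume gh: "g \<in> L2 m" "h \<in> L2 m"
    have "L2_norm m (P (s n) (\<lambda>x. a * g x + b * h x)) = L2_norm m (\<lambda>x. a * P (s n) g x + b * P (s n) h x)"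
      by (intro L2_norm_cong_AE lin L2_borel L2P L2_lincomb s gh)
    also have "\<dots> \<le> L2_norm m (\<lambda>x. a * P (s n) g x) + L2_norm m (\<lambda>x. b * P (s n) h x)"
      by (intro L2_norm_triangle L2_cmult L2P s gh)
    finally show "L2_norm m (P (s n) (\<lambda>x. a * g x + b * h x)) \<le> \<bar>a\<bar> * L2_norm m (P (s n) g) + \<bar>b\<bar> * L2_norm m (P (s n) h)"
      by (simp add: L2_norm_cmult)
  next
    fix g :: "'a \<Rightarrow> real" assume g: "g \<in> L2 m"
    have close: "\<forall>\<^sub>F t in at_right 0. L2_norm m (\<lambda>x. P t g x - g x) < 1"
      by (rule order_tendstoD(2)[OF cont[OF g]]) simp
    then obtain d where d: "d > 0" "\<And>t. 0 < t \<Longrightarrow> t < d \<Longrightarrow> L2_norm m (\<lambda>x. P t g x - g x) < 1"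
      by (auto simp: eventually_at_right_field)
    have "L2_norm m (P t g) \<le> 1 + L2_norm m g" if "0 \<le> t" "t < d" for t
    proof (cases "t = 0")
      case True
      have "L2_norm m (P 0 g) = L2_norm m g" by (intro L2_norm_cong_AE P0 L2_borel L2P g) simp
      with True show ?thesis by simp
    next
      case False
      have "L2_norm m (\<lambda>x. (P t g x - g x) + g x) \<le> L2_norm m (\<lambda>x. P t g x - g x) + L2_norm m g"
        by (intro L2_norm_triangle L2_diff L2P g that)
      with d(2)[of t] False that show ?thesis by simp
    qed
    then have "\<forall>\<^sub>F n in sequentially. norm (L2_norm m (P (s n) g)) \<le> 1 + L2_norm m g"
      by (intro eventually_mono[OF order_tendstoD(2)[OF s0 d(1)]]) (simp add: s L2_norm_nonneg)
    then show "Bseq (\<lambda>n. L2_norm m (P (s n) g))" by (rule BfunI)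
  qed (auto intro: L2_norm_nonneg bnd s)
  then obtain K where K: "\<And>n g. g \<in> L2 m \<Longrightarrow> L2_norm m (P (s n) g) \<le> K * L2_norm m g" by blast
  obtain n where n: "K \<le> real n" using real_arch_simple by blast
  have "L2_norm m (P (s n) (f n)) \<le> K * L2_norm m (f n)" by (rule K[OF f])
  also have "\<dots> \<le> real n * L2_norm m (f n)" by (intro mult_right_mono n L2_norm_nonneg)
  also note sf[of n]
  finally show False by simp
qed

text \<open>The error \<open>E t\<close> of the claimed equation satisfies \<open>E (s + h) \<le> K * E h + E s\<close>, where \<open>K\<close> bounds
\<open>P s\<close>, and the generator gives \<open>E h / h \<longlonglongrightarrow> 0\<close> as \<open>h \<rightarrow> 0\<close>.  Dividing \<open>[0, s]\<close> into \<open>n\<close> equal steps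
yields \<open>E s \<le> n * K * E (s / n) \<longlonglongrightarrow> 0\<close>.  The bound \<open>K\<close> has to be uniform on \<open>[0, s]\<close>, so this works
for small \<open>s\<close> only; the semigroup law extends the result to all times.\<close>
lemma semigroup_eigenvector:
  assumes sg: "semigroup_generated_by_minus m A P"
    and f: "f \<in> L2 m" and eig: "(f, \<lambda>x. \<mu> * f x) \<in> A" and \<mu>: "0 \<le> \<mu>" and t: "0 \<le> t"
  shows "AE x in m. P t f x = exp (- \<mu> * t) * f x"
proof -
  note L2P = semigroup_L2[OF sg] and lin = semigroup_linear[OF sg] and bnd = semigroup_bounded[OF sg]
    and P0 = semigroup_0[OF sg] and mult = semigroup_add[OF sg]
    and gen = semigroup_generator[OF sg f L2_cmult[OF f] eig]
  define R where "R = (\<lambda>t x. P t f x - exp (- \<mu> * t) * f x)"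
  define E where "E = (\<lambda>t. L2_norm m (R t))"
  have R: "R t \<in> L2 m" if "0 \<le> t" for t
    unfolding R_def by (intro L2_diff L2P L2_cmult f that)
  have E_nonneg: "0 \<le> E t" for t by (simp add: E_def L2_norm_nonneg)
  have step: "E (s + h) \<le> K * E h + E s"
    if s: "0 \<le> s" and h: "0 \<le> h" and K: "\<And>g. g \<in> L2 m \<Longrightarrow> L2_norm m (P s g) \<le> K * L2_norm m g" for s h K
  proof -
    have "AE x in m. P s (R h) x = P s (P h f) x - exp (- \<mu> * h) * P s f x"
      using lin[of s "P h f" f 1 "- exp (- \<mu> * h)"] L2P[OF h f] f s by (simp add: R_def)
    with mult[OF s h f] have "AE x in m. R (s + h) x = P s (R h) x + exp (- \<mu> * h) * R s x"
      by eventually_elim (simp add: R_def algebra_simps exp_add[symmetric])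
    then have "E (s + h) = L2_norm m (\<lambda>x. P s (R h) x + exp (- \<mu> * h) * R s x)"
      unfolding E_def by (intro L2_norm_cong_AE L2_borel L2_add L2_cmult L2P R s h add_nonneg_nonneg)
    also have "\<dots> \<le> L2_norm m (P s (R h)) + L2_norm m (\<lambda>x. exp (- \<mu> * h) * R s x)"
      by (intro L2_norm_triangle L2_cmult L2P R s h)
    also have "\<dots> \<le> K * E h + exp (- \<mu> * h) * E s"
      using K[OF R[OF h]] by (simp add: E_def L2_norm_cmult)
    also have "\<dots> \<le> K * E h + 1 * E s"
      using \<mu> h E_nonneg by (intro add_left_mono mult_right_mono) auto
    finally show ?thesis by simp
  qed
  have E0: "E 0 = 0"
  proof -
    have "E 0 = L2_norm m (\<lambda>x. 0 * f x)"
      unfolding E_def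
    proof (rule L2_norm_cong_AE)
      show "R 0 \<in> borel_measurable m" using R[of 0] by (simp add: L2_def)
      show "AE x in m. R 0 x = 0 * f x" using P0[OF f] by eventually_elim (simp add: R_def)
    qed simp
    then show ?thesis by (simp only: L2_norm_cmult)
  qed
  have iter: "E (real n * h) \<le> real n * K * E h"
    if h: "0 \<le> h" and K: "\<And>s g. 0 \<le> s \<Longrightarrow> s \<le> real n * h \<Longrightarrow> g \<in> L2 m \<Longrightarrow> L2_norm m (P s g) \<le> K * L2_norm m g" for n h K
  proof -
    have "E (real j * h) \<le> real j * K * E h" if "j \<le> n" for j
      using that
    proof (induction j)
      case 0
      then show ?case by (simp add: E0)
    next
      case (Suc j)
      have "real j * h \<le> real n * h" using Suc.prems h by (intro mult_right_mono) auto
      then have "E (real j * h + h) \<le> K * E h + E (real j * h)"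
        using h by (intro step K) auto
      with Suc show ?case by (simp add: algebra_simps)
    qed
    then show ?thesis by simp
  qed
  \<comment> \<open>\<open>R h / h\<close> is the sum of the error of the difference quotient of \<open>P\<close> and of the error of the
     difference quotient of \<open>exp (- \<mu> * h)\<close>, times \<open>f\<close>.\<close>
  have small_o: "((\<lambda>h. E h / h) \<longlongrightarrow> 0) (at_right 0)"
  proof (rule tendsto_sandwich[OF _ _ tendsto_const])
    have "((\<lambda>h. exp (- \<mu> * h)) has_real_derivative - \<mu>) (at 0)"
      by (auto intro!: derivative_eq_intros)
    then have "((\<lambda>h. (exp (- \<mu> * h) - 1) / h) \<longlongrightarrow> - \<mu>) (at_right 0)"
      unfolding has_field_derivative_iff by (auto intro: filterlim_mono[OF _ order_refl at_le])
    then have "((\<lambda>h. L2_norm m (\<lambda>x. (P h f x - f x) / h - (- (\<mu> * f x)))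
        + \<bar>- ((exp (- \<mu> * h) - 1) / h) - \<mu>\<bar> * L2_norm m f) \<longlongrightarrow> 0 + \<bar>- (- \<mu>) - \<mu>\<bar> * L2_norm m f) (at_right 0)"
      by (intro tendsto_intros gen)
    then show "((\<lambda>h. L2_norm m (\<lambda>x. (P h f x - f x) / h - (- (\<mu> * f x)))
        + \<bar>- ((exp (- \<mu> * h) - 1) / h) - \<mu>\<bar> * L2_norm m f) \<longlongrightarrow> 0) (at_right 0)" by simp
    show "\<forall>\<^sub>F h in at_right 0. E h / h \<le> L2_norm m (\<lambda>x. (P h f x - f x) / h - (- (\<mu> * f x)))
        + \<bar>- ((exp (- \<mu> * h) - 1) / h) - \<mu>\<bar> * L2_norm m f"
      using eventually_at_right_less[of 0]
    proof eventually_elim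
      case (elim h)
      have G: "(\<lambda>x. (P h f x - f x) / h - (- (\<mu> * f x))) \<in> L2 m"
        using L2_add[OF L2_cmult[OF L2_diff[OF L2P f], of h f "1 / h"] L2_cmult[OF f, of \<mu>]] f elim by simp
      have "E h / h = L2_norm m (\<lambda>x. (1 / h) * R h x)"
        using elim by (subst L2_norm_cmult) (simp add: E_def)
      also have "(\<lambda>x. (1 / h) * R h x) =
          (\<lambda>x. ((P h f x - f x) / h - (- (\<mu> * f x))) + (- ((exp (- \<mu> * h) - 1) / h) - \<mu>) * f x)"
        using elim by (auto simp: R_def field_simps)
      also have "L2_norm m \<dots> \<le> L2_norm m (\<lambda>x. (P h f x - f x) / h - (- (\<mu> * f x)))
          + L2_norm m (\<lambda>x. (- ((exp (- \<mu> * h) - 1) / h) - \<mu>) * f x)"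
        by (intro L2_norm_triangle G L2_cmult f)
      finally show ?case unfolding L2_norm_cmult .
    qed
    show "\<forall>\<^sub>F h in at_right 0. 0 \<le> E h / h"
      using eventually_at_right_less[of 0] by eventually_elim (simp add: E_nonneg)
  qed
  obtain \<delta> K where \<delta>: "\<delta> > 0" and "\<forall>s\<in>{0..\<delta>}. \<forall>g\<in>L2 m. L2_norm m (P s g) \<le> K * L2_norm m g"
    using semigroup_locally_bounded[OF sg] by blast
  then have K: "L2_norm m (P s g) \<le> K * L2_norm m g" if "0 \<le> s" "s \<le> \<delta>" "g \<in> L2 m" for s g
    using that by simp
  have E_small: "E s = 0" if s: "0 < s" "s \<le> \<delta>" for s
  proof -
    have "(\<lambda>n. s / real (Suc n)) \<longlonglongrightarrow> 0"
      using LIMSEQ_Suc[OF tendsto_divide_0[OF tendsto_const filterlim_real_sequentially[THEN filterlim_at_top_imp_at_infinity]]] .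
    then have "filterlim (\<lambda>n. s / real (Suc n)) (at_right 0) sequentially"
      using s by (auto simp: filterlim_at)
    then have "(\<lambda>n. E (s / real (Suc n)) / (s / real (Suc n))) \<longlonglongrightarrow> 0"
      by (rule filterlim_compose[OF small_o])
    then have "(\<lambda>n. s * K * (E (s / real (Suc n)) / (s / real (Suc n)))) \<longlonglongrightarrow> s * K * 0"
      by (intro tendsto_mult tendsto_const)
    moreover have "E s \<le> s * K * (E (s / real (Suc n)) / (s / real (Suc n)))" for n
    proof -
      have "E (real (Suc n) * (s / real (Suc n))) \<le> real (Suc n) * K * E (s / real (Suc n))"
        using s by (intro iter K) auto
      then show ?thesis using s by (simp add: field_simps del: of_nat_Suc)
    qed
    ultimately have "E s \<le> s * K * 0" by (intro LIMSEQ_le_const) auto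
    with E_nonneg[of s] show ?thesis by simp
  qed
  have "E (real n * h) = 0" if "0 < h" "h \<le> \<delta>" for n h
  proof (induction n)
    case (Suc n)
    have "0 \<le> real n * h" using that by simp
    then obtain K' where K': "\<forall>g\<in>L2 m. L2_norm m (P (real n * h) g) \<le> K' * L2_norm m g"
      using bnd by blast
    then have "E (real n * h + h) \<le> K' * E h + E (real n * h)" using that by (intro step) auto
    then have "E (real n * h + h) = 0" using Suc E_small[OF that] E_nonneg[of "real n * h + h"] by simp
    then show ?case by (simp add: algebra_simps)
  qed (simp add: E0)
  then have mult_h: "E (real n * h) = 0" if "0 < h" "h \<le> \<delta>" for n h using that by blast
  obtain N :: nat where N: "t / \<delta> < real N" using reals_Archimedean2 by blast
  have "E t = 0" if "t > 0"
  proof -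
    have "0 < real N" using N that \<delta> by (meson divide_pos_pos less_trans)
    moreover have "t < real N * \<delta>" using N \<delta> by (simp add: pos_divide_less_eq)
    ultimately have "0 < t / real N" "t / real N \<le> \<delta>" "real N * (t / real N) = t"
      using that by (simp_all add: pos_divide_le_eq mult.commute)
    with mult_h[of "t / real N" N] show ?thesis by simp
  qed
  with E0 t have "E t = 0" by (cases "t = 0") auto
  then have "AE x in m. R t x = 0" unfolding E_def by (intro L2_norm_zeroD R t)
  then show ?thesis by eventually_elim (simp add: R_def)
qed

section \<open>Balls, masses and eigenvalues\<close>

definition distances :: "'a::metric_space \<Rightarrow> real set" where
  "distances x = {dist x y |y. y \<noteq> x}"

lemma distances_pos: "r \<in> distances x \<Longrightarrow> 0 < r"
  by (auto simp: distances_def)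

lemma distances_nonsingleton:
  assumes "r \<in> distances x"
  shows "cball x r \<in> nonsingleton_balls"
proof -
  obtain y where "y \<noteq> x" "r = dist x y" using assms by (auto simp: distances_def)
  then have "x \<in> cball x r" "y \<in> cball x r" "0 < r" by auto
  with \<open>y \<noteq> x\<close> show ?thesis
    unfolding nonsingleton_balls_def
    by (intro CollectI exI[of _ x] exI[of _ r]) (metis is_singletonE singletonD)
qed

context ultrametric_measure_space
begin

lemma dist_less_trans: "dist (x::'a) y < r \<Longrightarrow> dist y z < r \<Longrightarrow> dist x z < r"
  using ultrametric[of x z y] by simp

lemma dist_le_trans: "dist (x::'a) y \<le> r \<Longrightarrow> dist y z \<le> r \<Longrightarrow> dist x z \<le> r"
  using ultrametric[of x z y] by simp

lemma ball_mem_cong: "dist (y::'a) z < r \<Longrightarrow> z \<in> ball x r \<longleftrightarrow> y \<in> ball x r"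
  using dist_less_trans[of x y r z] dist_less_trans[of x z r y] by (auto simp: dist_commute)

lemma cball_mem_cong: "dist (y::'a) z \<le> r \<Longrightarrow> z \<in> cball x r \<longleftrightarrow> y \<in> cball x r"
  using dist_le_trans[of x y r z] dist_le_trans[of x z r y] by (auto simp: dist_commute)

lemma cball_recenter: "dist (x::'a) y \<le> r \<Longrightarrow> cball y r = cball x r"
  using cball_mem_cong[of x _ r y] cball_mem_cong[of y _ r x] cball_mem_cong[of x y r]
  by (metis (no_types, opaque_lifting) dist_commute mem_cball subsetI subset_antisym)

lemma dist_eq_of_less: "dist (y::'a) z < dist x y \<Longrightarrow> dist x z = dist x y"
  using ultrametric[of x z y] ultrametric[of x y z] by (simp add: dist_commute)

text \<open>Cover the compact ball \<open>cball x b\<close> by finitely many balls of radius \<open>a\<close>: outside of \<open>ball x a\<close>, the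
distance from \<open>x\<close> is constant on each of them.\<close>
lemma finite_distances:
  fixes x :: 'a
  assumes "0 < a"
  shows "finite (distances x \<inter> {a..b})"
proof -
  obtain k where k: "finite k" "cball x b \<subseteq> (\<Union>y\<in>k. ball y a)"
    using proper[of x b] assms unfolding compact_eq_totally_bounded by blast
  have "distances x \<inter> {a..b} \<subseteq> dist x ` k"
  proof
    fix r assume "r \<in> distances x \<inter> {a..b}"
    then obtain z where z: "r = dist x z" "a \<le> dist x z" "z \<in> cball x b"
      by (auto simp: distances_def)
    with k obtain y where "y \<in> k" "dist z y < a" by (auto simp: dist_commute)
    with z dist_eq_of_less[of z y x] have "r = dist x y" by simp
    with \<open>y \<in> k\<close> show "r \<in> dist x ` k" by simp
  qed
  then show ?thesis using k(1) by (meson finite_imageI finite_subset)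
qed

lemma distances_unbounded: "\<exists>r\<in>distances (x::'a). b < r"
proof (rule ccontr)
  assume "\<not> ?thesis"
  then have "dist x y \<le> max b 0" for y
    by (cases "y = x") (auto simp: distances_def le_max_iff_disj not_less)
  then have "cball x (max b 0) = UNIV" by auto
  with proper[of x "max b 0"] noncompact show False by simp
qed

text \<open>No distance lies strictly between two consecutive ones \<open>r < s\<close>, so \<open>cball x r = ball x s\<close> and the
sum telescopes.\<close>
lemma sum_distances_telescope:
  fixes F :: "'a set \<Rightarrow> real"
  assumes a: "0 < a" and ab: "a \<le> b"
  shows "(\<Sum>r\<in>distances x \<inter> {a..<b}. F (ball x r) - F (cball x r)) = F (ball x a) - F (ball x b)"
  using ab
proof (induction "card (distances x \<inter> {a..<b})" arbitrary: b)
  case (0 b)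
  have fin: "finite (distances x \<inter> {a..<b})"
    by (rule finite_subset[OF _ finite_distances[OF a, of x b]]) auto
  with 0 have empty: "distances x \<inter> {a..<b} = {}" by simp
  have "ball x b = ball x a"
  proof (rule set_eqI)
    fix y show "y \<in> ball x b \<longleftrightarrow> y \<in> ball x a"
      using empty a \<open>a \<le> b\<close> by (cases "y = x") (force simp: distances_def)+
  qed
  with empty show ?case by simp
next
  case (Suc n b)
  define I where "I = distances x \<inter> {a..<b}"
  have fin: "finite I"
    unfolding I_def by (rule finite_subset[OF _ finite_distances[OF a, of x b]]) auto
  have "I \<noteq> {}" using Suc.hyps(2) by (auto simp: I_def[symmetric])
  define r where "r = Max I"
  have rI: "r \<in> I" and rmax: "\<And>s. s \<in> I \<Longrightarrow> s \<le> r"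
    using fin \<open>I \<noteq> {}\<close> by (auto simp: r_def)
  then have r: "r \<in> distances x" "a \<le> r" "r < b" by (auto simp: I_def)
  define I' where "I' = distances x \<inter> {a..<r}"
  have I: "I = insert r I'" "r \<notin> I'"
    using r rmax by (force simp: I_def I'_def)+
  have "finite I'" using fin I by simp
  \<comment> \<open>No distance lies between \<open>r\<close> and \<open>b\<close>.\<close>
  have cb: "ball x b = cball x r"
  proof (rule set_eqI)
    fix y show "y \<in> ball x b \<longleftrightarrow> y \<in> cball x r"
    proof (cases "y = x \<or> dist x y < a")
      case True
      then show ?thesis using r a by auto
    next
      case False
      then have "dist x y < b \<Longrightarrow> dist x y \<in> I" by (auto simp: I_def distances_def)
      with rmax r show ?thesis unfolding mem_ball mem_cball by (meson le_less_trans)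
    qed
  qed
  have "n = card I'" using Suc.hyps(2) I \<open>finite I'\<close> by (simp add: I_def[symmetric])
  with Suc.hyps(1)[of r] r have "(\<Sum>r\<in>I'. F (ball x r) - F (cball x r)) = F (ball x a) - F (ball x r)"
    by (simp add: I'_def)
  then show ?case using I \<open>finite I'\<close> cb by (simp add: I_def[symmetric])
qed

lemma sets_m: "sets m = sets borel"
  using radon by (simp add: radon_measure_def)

lemma sets_balls [measurable, simp]: "ball x r \<in> sets m" "cball x r \<in> sets m"
  by (simp_all add: sets_m)

lemma emeasure_cball_finite: "emeasure m (cball x r) < \<infinity>"
  using radon proper unfolding radon_measure_def by blast

lemma emeasure_ball_finite: "emeasure m (ball x r) < \<infinity>"
  by (rule le_less_trans[OF emeasure_mono[OF ball_subset_cball] emeasure_cball_finite]) simp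

lemma fmeasurable_balls [simp]: "ball x r \<in> fmeasurable m" "cball x r \<in> fmeasurable m"
  using emeasure_ball_finite emeasure_cball_finite by (auto intro!: fmeasurableI)

lemma cball_mass_pos:
  assumes "0 < r"
  shows "0 < measure m (cball x r)"
proof -
  have "0 < emeasure m (cball x r)"
  proof (cases "is_singleton (cball x r)")
    case True
    then obtain z where "cball x r = {z}" by (auto elim: is_singletonE)
    moreover have "x \<in> cball x r" using assms by simp
    ultimately have x: "cball x r = {x}" by simp
    then have "x isolated_in UNIV"
      unfolding isolated_in_def using assms ball_subset_cball[of x r]
      by (intro conjI UNIV_I exI[of _ "ball x r"]) auto
    then show ?thesis using point_pos_iff x by simp
  next
    case False
    then show ?thesis using assms by (intro ball_pos) (auto simp: nonsingleton_balls_def)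
  qed
  then show ?thesis
    using emeasure_cball_finite[of x r] by (simp add: measure_def enn2real_positive_iff)
qed

lemma ball_mass_pos:
  assumes "0 < r"
  shows "0 < measure m (ball x r)"
proof -
  have "cball x (r / 2) \<subseteq> ball x r" using assms by auto
  then have "measure m (cball x (r / 2)) \<le> measure m (ball x r)"
    by (intro measure_mono_fmeasurable) auto
  with cball_mass_pos[of "r / 2" x] assms show ?thesis by simp
qed

text \<open>The balls around \<open>x\<close> exhaust the space, whose total mass is infinite.\<close>
lemma ball_mass_at_top: "filterlim (\<lambda>R. measure m (ball x R)) at_top at_top"
  unfolding filterlim_at_top
proof
  fix Z :: real
  have UN: "(\<Union>n. ball x (real n)) = UNIV"
    using reals_Archimedean2 by (auto simp: mem_ball)
  have "(\<lambda>n. emeasure m (ball x (real n))) \<longlonglongrightarrow> emeasure m (\<Union>n. ball x (real n))"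
    by (rule Lim_emeasure_incseq) (auto simp: incseq_def)
  then have "(\<lambda>n. emeasure m (ball x (real n))) \<longlonglongrightarrow> \<infinity>"
    unfolding UN infinite_mass .
  then have "\<forall>\<^sub>F n in sequentially. ennreal Z < emeasure m (ball x (real n))"
    by (rule order_tendstoD(1)) simp
  then obtain n where n: "ennreal Z < emeasure m (ball x (real n))"
    using eventually_happens' sequentially_bot by blast
  have "Z \<le> measure m (ball x (real n))"
  proof (rule ccontr)
    assume "\<not> ?thesis"
    then have "emeasure m (ball x (real n)) \<le> ennreal Z"
      using emeasure_ball_finite[of x "real n"]
      by (subst emeasure_eq_ennreal_measure) (auto intro!: ennreal_leI)
    with n show False by simp
  qed
  moreover have "measure m (ball x (real n)) \<le> measure m (ball x R)" if "real n \<le> R" for R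
    using that by (intro measure_mono_fmeasurable subset_ball) auto
  ultimately show "\<forall>\<^sub>F R in at_top. Z \<le> measure m (ball x R)"
    unfolding eventually_at_top_linorder by (meson order_trans)
qed

end

context ultrametric_measure_space_choice
begin

lemma eigval_pos:
  assumes "B \<in> nonsingleton_balls"
  shows "0 < eigval C B"
proof -
  have "C B \<le> eigval C B"
    unfolding eigval_def using assms finite_sum_le_infsum[OF C_summable_above[OF assms], of "{B}"] C_pos
    by (auto simp: less_imp_le)
  with C_pos[OF assms] show ?thesis by simp
qed

text \<open>\<open>cball x r\<close> itself is among the balls that contain \<open>cball x r\<close> but not among those that contain
\<open>cball x s\<close>, and its contribution \<open>C (cball x r)\<close> is positive.\<close>
lemma eigval_decreasing:
  assumes r: "r \<in> distances x" "s \<in> distances x" "r < s"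
  shows "eigval C (cball x s) < eigval C (cball x r)"
proof -
  define U where "U = (\<lambda>r. {D \<in> nonsingleton_balls. cball x r \<subseteq> D})"
  have eig: "eigval C (cball x r) = infsum C (U r)" for r by (simp add: eigval_def U_def)
  note ns = distances_nonsingleton[OF r(1)] distances_nonsingleton[OF r(2)]
  obtain y where y: "dist x y = s" using r(2) by (auto simp: distances_def)
  then have nsub: "\<not> cball x s \<subseteq> cball x r" using r(3) by auto
  have sum: "C summable_on U r" "C summable_on U s"
    unfolding U_def using C_summable_above ns by auto
  have "C (cball x r) + eigval C (cball x s) = infsum C (insert (cball x r) (U s))"
    using sum nsub unfolding eig
    by (subst infsum_insert) (auto simp: U_def)
  also have "\<dots> \<le> eigval C (cball x r)"
    unfolding eig
  proof (rule infsum_mono2)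
    show "C summable_on insert (cball x r) (U s)" using sum by (simp add: summable_on_insert_iff)
    show "insert (cball x r) (U s) \<subseteq> U r"
      using ns r(3) subset_cball[of r s x] by (auto simp: U_def)
  qed (use sum C_pos in \<open>auto simp: U_def less_imp_le\<close>)
  finally show ?thesis using C_pos[OF ns(1)] by simp
qed

text \<open>The eigenvalues are tails of a convergent series: a finite set of balls carries all but a small part
of \<open>eigval C (cball x r0)\<close>, and a large ball is contained in none of them.\<close>
lemma eigval_small:
  assumes "0 < e"
  shows "\<exists>r\<in>distances x. b < r \<and> eigval C (cball x r) < e"
proof -
  obtain r0 where r0: "r0 \<in> distances x" "b < r0" using distances_unbounded by blast
  define U where "U = (\<lambda>r. {D \<in> nonsingleton_balls. cball x r \<subseteq> D})"
  have eig: "eigval C (cball x r) = infsum C (U r)" for r by (simp add: eigval_def U_def)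
  have sum: "C summable_on U r" if "r \<in> distances x" for r
    unfolding U_def using C_summable_above distances_nonsingleton[OF that] by auto
  obtain F where F: "finite F" "F \<subseteq> U r0" "dist (sum C F) (infsum C (U r0)) \<le> e / 2"
    using infsum_finite_approximation[OF sum[OF r0(1)], of "e / 2"] assms by auto
  have "bounded (\<Union>F)"
    using F(1,2) by (intro bounded_Union) (auto simp: U_def nonsingleton_balls_def)
  then obtain R where "\<forall>y\<in>\<Union>F. dist x y \<le> R" unfolding bounded_any_center[of _ x] by blast
  then have R: "\<Union>F \<subseteq> cball x R" by auto
  obtain r where r: "r \<in> distances x" "max R r0 < r" using distances_unbounded by blast
  obtain y where y: "dist x y = r" using r(1) by (auto simp: distances_def)
  have "y \<notin> cball x R" using y r(2) by auto
  then have disj: "F \<inter> U r = {}" using R y by (force simp: U_def)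
  have sub: "F \<union> U r \<subseteq> U r0"
    using F(2) r(2) subset_cball[of r0 r x] by (auto simp: U_def)
  have "sum C F + eigval C (cball x r) = infsum C (F \<union> U r)"
    unfolding eig using F(1) disj sum[OF r(1)]
    by (subst infsum_Un_disjoint) auto
  also have "\<dots> \<le> infsum C (U r0)"
    using sub sum[OF r0(1)] C_pos summable_on_subset_banach[OF sum[OF r0(1)] sub]
    by (intro infsum_mono2) (auto simp: U_def less_imp_le)
  finally have "eigval C (cball x r) < e" using F(3) assms unfolding dist_real_def by linarith
  with r r0 show ?thesis by (intro bexI[of _ r]) auto
qed

text \<open>The radius \<open>1 / eigval C (cball x r)\<close> increases with \<open>r\<close>, so the intrinsic closed balls with these
radii are the closed balls of the original metric.\<close>
lemma intrinsic_ball_eq: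
  assumes "r \<in> distances x"
  shows "{y. intrinsic_dist C x y \<le> 1 / eigval C (cball x r)} = cball x r"
proof (rule set_eqI)
  fix y
  show "y \<in> {y. intrinsic_dist C x y \<le> 1 / eigval C (cball x r)} \<longleftrightarrow> y \<in> cball x r"
  proof (cases "y = x")
    case True
    then show ?thesis
      using eigval_pos[OF distances_nonsingleton[OF assms]] distances_pos[OF assms]
      by (simp add: intrinsic_dist_def)
  next
    case False
    then have y: "dist x y \<in> distances x" by (auto simp: distances_def)
    have "1 / eigval C (cball x (dist x y)) \<le> 1 / eigval C (cball x r) \<longleftrightarrow> eigval C (cball x r) \<le> eigval C (cball x (dist x y))"
      using eigval_pos[OF distances_nonsingleton[OF y]] eigval_pos[OF distances_nonsingleton[OF assms]]
      by (simp add: field_simps)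
    also have "\<dots> \<longleftrightarrow> dist x y \<le> r"
      using eigval_decreasing[OF y assms] eigval_decreasing[OF assms y]
      by (metis linorder_not_le order_less_asym order_le_less)
    finally show ?thesis using False by (simp add: intrinsic_dist_def)
  qed
qed

lemma intrinsic_ball_subset:
  assumes r: "r \<in> distances x" and s: "s < 1 / eigval C (cball x r)"
  shows "{y. intrinsic_dist C x y \<le> s} \<subseteq> ball x r"
proof
  fix y assume y: "y \<in> {y. intrinsic_dist C x y \<le> s}"
  then have "y \<in> {y. intrinsic_dist C x y \<le> 1 / eigval C (cball x r)}" using s by simp
  then have "y \<in> cball x r" unfolding intrinsic_ball_eq[OF r] .
  moreover have "dist x y \<noteq> r"
  proof
    assume "dist x y = r"
    then have "intrinsic_dist C x y = 1 / eigval C (cball x r)"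
      using distances_pos[OF r] by (auto simp: intrinsic_dist_def)
    with y s show False by simp
  qed
  ultimately show "y \<in> ball x r" by simp
qed

text \<open>For large \<open>s\<close> the intrinsic ball is open, and it lies between two balls of the original metric, so
its measure is finite and positive.\<close>
lemma intrinsic_vol_pos: "\<forall>\<^sub>F s in at_top. 0 < intrinsic_vol m C x s"
proof -
  obtain r where r: "r \<in> distances x" using distances_unbounded by blast
  have "0 < intrinsic_vol m C x s" if s: "1 / eigval C (cball x r) \<le> s" for s
  proof -
    define S where "S = {y. intrinsic_dist C x y \<le> s}"
    have sub: "cball x r \<subseteq> S"
      using s by (subst intrinsic_ball_eq[OF r, symmetric]) (auto simp: S_def)
    have "open S"
      unfolding open_contains_ball
    proof
      fix y assume y: "y \<in> S"
      show "\<exists>e>0. ball y e \<subseteq> S"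
      proof (cases "y = x")
        case True
        with sub distances_pos[OF r] ball_subset_cball[of x r] show ?thesis by blast
      next
        case False
        have "z \<in> S" if "z \<in> ball y (dist x y)" for z
        proof -
          have "dist x z = dist x y" using that by (intro dist_eq_of_less) simp
          moreover from this False have "z \<noteq> x" by auto
          ultimately show ?thesis using y False by (simp add: S_def intrinsic_dist_def)
        qed
        then have "ball y (dist x y) \<subseteq> S" by blast
        with False show ?thesis by (intro exI[of _ "dist x y"]) auto
      qed
    qed
    then have "S \<in> sets m" by (simp add: sets_m)
    moreover define T where "T = max s 1"
    then have T: "0 < T" "s \<le> T" by simp_all
    obtain r' where r': "r' \<in> distances x" "eigval C (cball x r') < 1 / T"
      using eigval_small[of "1 / T" x 0] T(1) by auto
    have "T < 1 / eigval C (cball x r')"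
      using r'(2) eigval_pos[OF distances_nonsingleton[OF r'(1)]] T(1) by (simp add: field_simps)
    with T(2) have "s < 1 / eigval C (cball x r')" by simp
    then have "S \<subseteq> ball x r'"
      unfolding S_def by (intro intrinsic_ball_subset r'(1))
    then have "S \<in> fmeasurable m"
      using fmeasurableI2[OF fmeasurable_balls(1) _ \<open>S \<in> sets m\<close>] by blast
    then have "measure m (cball x r) \<le> measure m S"
      using sub by (intro measure_mono_fmeasurable) auto
    with cball_mass_pos[OF distances_pos[OF r], of x] show ?thesis
      by (simp add: intrinsic_vol_def S_def)
  qed
  then show ?thesis using eventually_ge_at_top by (rule eventually_mono[rotated])
qed

end

context homogeneous_hierarchical_laplacian
begin

lemma ball_mass_homogeneous: "measure m (ball x r) = measure m (ball y r)"
proof -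
  obtain G :: "('a \<Rightarrow> 'a) set" where G: "isometry_group G" "\<forall>x y. \<exists>g\<in>G. g x = y"
      "\<forall>g\<in>G. \<forall>A\<in>sets borel. emeasure m (g ` A) = emeasure m A"
    using homogeneous by blast
  then obtain g where g: "g \<in> G" "g x = y" by blast
  then have iso: "bij g" "\<And>u v. dist (g u) (g v) = dist u v"
    using G(1) by (auto simp: isometry_group_def)
  have "g ` ball x r = ball y r"
  proof (intro equalityI subsetI)
    fix z assume z: "z \<in> ball y r"
    obtain w where "z = g w" using iso(1) by (metis bij_pointE)
    with z g(2) iso(2)[of x w] show "z \<in> g ` ball x r" by auto
  qed (use g(2) iso(2) in auto)
  then have "emeasure m (ball y r) = emeasure m (ball x r)"
    using G(3) g(1) by (metis borel_open open_ball)
  then show ?thesis by (simp add: measure_def)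
qed

text \<open>A point at distance exactly \<open>r\<close> from \<open>x\<close> is the centre of a second open ball of radius \<open>r\<close> in
\<open>cball x r\<close>.  It is disjoint from \<open>ball x r\<close>, and an isometry maps one to the other.\<close>
lemma ball_mass_doubling:
  assumes "r \<in> distances x"
  shows "2 * measure m (ball x r) \<le> measure m (cball x r)"
proof -
  obtain y where y: "dist x y = r" using assms by (auto simp: distances_def)
  have disj: "ball x r \<inter> ball y r = {}"
  proof (rule ccontr)
    assume "ball x r \<inter> ball y r \<noteq> {}"
    then obtain z where "dist x z < r" "dist z y < r" by (auto simp: dist_commute)
    with ultrametric[of x y z] y show False by simp
  qed
  have "ball y r \<subseteq> cball x r"
    using cball_recenter[of x y r] ball_subset_cball[of y r] y by simp
  then have "measure m (ball x r \<union> ball y r) \<le> measure m (cball x r)"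
    using ball_subset_cball[of x r] by (intro measure_mono_fmeasurable) auto
  moreover have "measure m (ball x r \<union> ball y r) = measure m (ball x r) + measure m (ball y r)"
    by (rule measure_Un_AE) (use disj in \<open>auto intro!: AE_I2\<close>)
  ultimately show ?thesis using ball_mass_homogeneous[of y r x] by simp
qed

text \<open>At \<open>1 / eigval C (cball x r)\<close> the intrinsic ball grows from a subset of \<open>ball x r\<close> to \<open>cball x r\<close>.\<close>
lemma intrinsic_vol_jump:
  assumes r: "r \<in> distances x" and s: "s < 1 / eigval C (cball x r)"
  shows "2 * intrinsic_vol m C x s \<le> intrinsic_vol m C x (1 / eigval C (cball x r))"
proof -
  define S where "S = {y. intrinsic_dist C x y \<le> s}"
  \<comment> \<open>If \<open>S\<close> is not measurable, its measure is \<open>0\<close> by convention.\<close>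
  have "measure m S \<le> measure m (ball x r)"
  proof (cases "S \<in> sets m")
    case True
    then show ?thesis
      using intrinsic_ball_subset[OF r s] by (intro measure_mono_fmeasurable) (auto simp: S_def)
  next
    case False
    then show ?thesis by (simp add: measure_notin_sets)
  qed
  with ball_mass_doubling[OF r] show ?thesis
    by (simp add: intrinsic_vol_def intrinsic_ball_eq[OF r] S_def)
qed

end

section \<open>Haar functions as eigenfunctions of the hierarchical Laplacian\<close>

definition averaging_density :: "'a measure \<Rightarrow> 'a set \<Rightarrow> 'a \<Rightarrow> real" where
  "averaging_density m B y = indicator B y / measure m B"

lemma averaging_density_integral:
  assumes B: "B \<in> fmeasurable m" and pos: "0 < measure m B"
  shows "integrable m (averaging_density m B)" "(LINT y|m. averaging_density m B y) = 1"
proof -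
  have int: "integrable m (indicator B :: 'a \<Rightarrow> real)" and val: "(LINT y|m. indicator B y) = measure m B"
    using B by (simp_all add: fmeasurable_def)
  show "integrable m (averaging_density m B)"
    unfolding averaging_density_def by (intro integrable_divide int)
  show "(LINT y|m. averaging_density m B y) = 1"
    using val pos unfolding averaging_density_def integral_divide_zero by simp
qed

lemma averaging_density_L2:
  assumes B: "B \<in> fmeasurable m" and pos: "0 < measure m B"
  shows "averaging_density m B \<in> L2 m" "L2_norm m (averaging_density m B) = 1 / sqrt (measure m B)"
proof -
  have sq: "(averaging_density m B y)\<^sup>2 = averaging_density m B y / measure m B" for y
    by (simp add: averaging_density_def power2_eq_square indicator_def)
  note int = averaging_density_integral[OF B pos]
  show "averaging_density m B \<in> L2 m"
    unfolding L2_def using int(1) by (auto simp: sq)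
  have "(L2_norm m (averaging_density m B))\<^sup>2 = 1 / measure m B"
    unfolding L2_norm_sq sq using int(2) by simp
  then have "L2_norm m (averaging_density m B) = sqrt (1 / measure m B)"
    by (metis L2_norm_nonneg real_sqrt_unique)
  then show "L2_norm m (averaging_density m B) = 1 / sqrt (measure m B)"
    by (simp add: real_sqrt_divide)
qed

lemma average_close:
  assumes B: "B \<in> fmeasurable m" and pos: "0 < measure m B"
    and int: "integrable m (\<lambda>y. h y * averaging_density m B y)"
    and close: "AE y in m. y \<in> B \<longrightarrow> \<bar>h y - c\<bar> \<le> e"
  shows "\<bar>(LINT y|m. h y * averaging_density m B y) - c\<bar> \<le> e"
proof -
  note g = averaging_density_integral[OF B pos]
  have const: "(LINT y|m. d * averaging_density m B y) = d" for d using g(2) by simp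
  have ge: "0 \<le> averaging_density m B y" for y by (simp add: averaging_density_def)
  have "(LINT y|m. h y * averaging_density m B y) \<le> (LINT y|m. (c + e) * averaging_density m B y)"
  proof (rule integral_mono_AE)
    show "AE y in m. h y * averaging_density m B y \<le> (c + e) * averaging_density m B y"
      using close
    proof eventually_elim
      case (elim y)
      then show ?case
        using ge[of y] by (cases "y \<in> B") (auto intro!: mult_right_mono simp: averaging_density_def divide_right_mono)
    qed
  qed (use int g(1) in auto)
  moreover have "(LINT y|m. (c - e) * averaging_density m B y) \<le> (LINT y|m. h y * averaging_density m B y)"
  proof (rule integral_mono_AE)
    show "AE y in m. (c - e) * averaging_density m B y \<le> h y * averaging_density m B y"
      using close
    proof eventually_elim
      case (elim y)
      then show ?case
        using ge[of y] by (cases "y \<in> B") (auto intro!: mult_right_mono simp: averaging_density_def divide_right_mono)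
    qed
  qed (use int g(1) in auto)
  ultimately show ?thesis unfolding const by linarith
qed

text \<open>For \<open>r \<in> distances x\<close> these are the Haar-like functions of a ball and its parent.  They are
eigenfunctions of the hierarchical Laplacian, and the averaging density of any ball around \<open>x\<close> is a
telescoping sum of them.\<close>
definition haar :: "'a::metric_space measure \<Rightarrow> 'a \<Rightarrow> real \<Rightarrow> 'a \<Rightarrow> real" where
  "haar m x r y = averaging_density m (ball x r) y - averaging_density m (cball x r) y"

context ultrametric_measure_space
begin

lemma haar_L2:
  assumes "0 < r"
  shows "haar m x r \<in> L2 m"
  unfolding haar_def
  by (intro L2_diff averaging_density_L2 fmeasurable_balls ball_mass_pos cball_mass_pos assms)

lemma haar_integral:
  assumes "0 < r"
  shows "(LINT y|m. haar m x r y) = 0"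
  unfolding haar_def
  using averaging_density_integral[OF fmeasurable_balls(1) ball_mass_pos[OF assms]]
    averaging_density_integral[OF fmeasurable_balls(2) cball_mass_pos[OF assms]]
  by simp

lemma haar_locally_constant:
  assumes "dist y z < r"
  shows "haar m x r z = haar m x r y"
  using ball_mem_cong[OF assms, of x] cball_mem_cong[OF less_imp_le[OF assms], of x]
  by (simp add: haar_def averaging_density_def indicator_def del: mem_ball mem_cball)

lemma haar_outside:
  assumes "y \<notin> cball x r"
  shows "haar m x r y = 0"
proof -
  have "y \<notin> ball x r" using assms ball_subset_cball by blast
  with assms show ?thesis by (simp add: haar_def averaging_density_def del: mem_ball mem_cball)
qed

lemma haar_inside:
  assumes "y \<in> ball x r"
  shows "haar m x r y = 1 / measure m (ball x r) - 1 / measure m (cball x r)"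
proof -
  have "y \<in> cball x r" using assms ball_subset_cball by blast
  with assms show ?thesis by (simp add: haar_def averaging_density_def del: mem_ball mem_cball)
qed

lemma haar_test_function:
  assumes "0 < r"
  shows "haar m x r \<in> test_functions"
  unfolding test_functions_def
proof (intro CollectI conjI allI)
  fix y
  show "\<exists>U. open U \<and> y \<in> U \<and> haar m x r constant_on U"
  proof (intro exI conjI)
    show "haar m x r constant_on ball y r"
      unfolding constant_on_def
      by (intro exI[of _ "haar m x r y"] ballI haar_locally_constant) simp
  qed (use assms in auto)
next
  have "{y. haar m x r y \<noteq> 0} \<subseteq> cball x r" using haar_outside by blast
  then have "closure {y. haar m x r y \<noteq> 0} \<subseteq> cball x r" by (intro closure_minimal) auto
  then show "compact (closure {y. haar m x r y \<noteq> 0})"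
    using proper compact_Int_closed[of "cball x r" "closure {y. haar m x r y \<noteq> 0}"]
    by (simp add: Int_absorb1)
qed

text \<open>A ball that contains \<open>y\<close> either contains \<open>cball x r\<close>, and then the average of the Haar function over
it is \<open>0\<close>; or it is disjoint from \<open>cball x r\<close>; or its radius is less than \<open>r\<close>.  In the last two
cases the Haar function is constant on it.\<close>
lemma haar_laplacian_term:
  assumes r: "r \<in> distances x" and B: "B \<in> nonsingleton_balls" "y \<in> B"
  shows "haar m x r y - (1 / measure m B) * (LINT z:B|m. haar m x r z) =
    (if cball x r \<subseteq> B then haar m x r y else 0)"
proof -
  define f where "f = haar m x r"
  have r0: "0 < r" by (rule distances_pos[OF r])
  obtain b s where bs: "B = cball b s" "0 < s" using B(1) by (auto simp: nonsingleton_balls_def)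
  then have Bs: "B = cball y s" using cball_recenter[of b y s] B(2) by simp
  consider "s < r" | "r \<le> s" "cball x r \<inter> B = {}" | "r \<le> s" "cball x r \<inter> B \<noteq> {}" by linarith
  then have "f y - (1 / measure m B) * (LINT z:B|m. f z) = (if cball x r \<subseteq> B then f y else 0)"
  proof cases
    case 1
    have const: "f z = f y" if "z \<in> B" for z
      unfolding f_def using that 1 Bs by (intro haar_locally_constant) auto
    have "(LINT z:B|m. f z) = (LINT z|m. f y * indicator B z)"
      unfolding set_lebesgue_integral_def
      by (intro Bochner_Integration.integral_cong) (auto simp: const split: split_indicator)
    also have "\<dots> = f y * measure m B" using fmeasurable_balls(2)[of y s] Bs by (simp add: fmeasurable_def)
    finally have "(1 / measure m B) * (LINT z:B|m. f z) = f y"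
      using cball_mass_pos[OF bs(2), of y] Bs by simp
    moreover have "\<not> cball x r \<subseteq> B"
    proof
      assume sub: "cball x r \<subseteq> B"
      obtain w where w: "dist x w = r" using r by (auto simp: distances_def)
      then have "x \<in> cball x r" "w \<in> cball x r" using r0 by auto
      then have "x \<in> B" "w \<in> B" using sub by blast+
      then have "dist y x \<le> s" "dist y w \<le> s" using Bs by simp_all
      then have "dist x w \<le> s" using dist_le_trans[of x y s w] by (simp add: dist_commute)
      with w 1 show False by simp
    qed
    ultimately show ?thesis by simp
  next
    case 2
    have zero: "f z = 0" if "z \<in> B" for z
      unfolding f_def using that 2 by (intro haar_outside) auto
    have "(LINT z:B|m. f z) = (LINT z|m. 0)"
      unfolding set_lebesgue_integral_def
      by (intro Bochner_Integration.integral_cong) (auto simp: zero split: split_indicator)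
    with zero[OF B(2)] show ?thesis by simp
  next
    case 3
    then obtain w where "dist x w \<le> r" "dist y w \<le> s" using Bs by auto
    then have "cball x r = cball w r" "B = cball w s"
      using cball_recenter Bs by simp_all
    then have sub: "cball x r \<subseteq> B" using 3 by (simp add: subset_cball)
    have "(LINT z:B|m. f z) = (LINT z|m. f z)"
      unfolding set_lebesgue_integral_def using sub haar_outside[of _ x r]
      by (intro Bochner_Integration.integral_cong) (auto simp: f_def split: split_indicator simp del: mem_cball)
    with sub show ?thesis by (simp add: f_def haar_integral[OF r0])
  qed
  then show ?thesis by (simp add: f_def)
qed

end

context ultrametric_measure_space_choice
begin

text \<open>Only the balls that contain \<open>cball x r\<close> contribute to the Laplacian, and their weights \<open>C B\<close> add up
to the eigenvalue.\<close>
lemma haar_eigenfunction: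
  assumes r: "r \<in> distances x"
  shows "hier_laplacian m C (haar m x r) = (\<lambda>y. eigval C (cball x r) * haar m x r y)"
proof
  fix y
  have "hier_laplacian m C (haar m x r) y =
      (\<Sum>\<^sub>\<infinity>B\<in>{D \<in> nonsingleton_balls. cball x r \<subseteq> D}. C B * haar m x r y)"
    unfolding hier_laplacian_def
  proof (rule infsum_cong_neutral)
    fix B assume "B \<in> {D \<in> nonsingleton_balls. cball x r \<subseteq> D} - {B \<in> nonsingleton_balls. y \<in> B}"
    then have "y \<notin> cball x r" by auto
    then have "haar m x r y = 0" by (rule haar_outside)
    then show "C B * haar m x r y = 0" by simp
  next
    fix B assume "B \<in> {B \<in> nonsingleton_balls. y \<in> B} - {D \<in> nonsingleton_balls. cball x r \<subseteq> D}"
    then show "C B * (haar m x r y - 1 / measure m B * (LINT y:B|m. haar m x r y)) = 0"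
      using haar_laplacian_term[OF r, of B y] by simp
  next
    fix B assume "B \<in> {B \<in> nonsingleton_balls. y \<in> B} \<inter> {D \<in> nonsingleton_balls. cball x r \<subseteq> D}"
    then show "C B * (haar m x r y - 1 / measure m B * (LINT y:B|m. haar m x r y)) = C B * haar m x r y"
      using haar_laplacian_term[OF r, of B y] by simp
  qed
  also have "\<dots> = eigval C (cball x r) * haar m x r y"
    unfolding eigval_def by (rule infsum_cmult_left')
  finally show "hier_laplacian m C (haar m x r) y = eigval C (cball x r) * haar m x r y" .
qed

end

section \<open>The spectral formula for the on-diagonal heat kernel\<close>

lemma nonneg_has_sumI:
  fixes f :: "'i \<Rightarrow> real"
  assumes nonneg: "\<And>i. i \<in> A \<Longrightarrow> 0 \<le> f i"
    and upper: "\<And>F. finite F \<Longrightarrow> F \<subseteq> A \<Longrightarrow> sum f F \<le> S"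
    and approx: "\<And>e. 0 < e \<Longrightarrow> \<exists>F. finite F \<and> F \<subseteq> A \<and> S - e \<le> sum f F"
  shows "(f has_sum S) A"
proof -
  have sum: "f summable_on A"
    using nonneg upper by (intro nonneg_bdd_above_summable_on bdd_aboveI[of _ S]) auto
  have "infsum f A \<le> S" by (rule infsum_le_finite_sums[OF sum upper])
  moreover have "S \<le> infsum f A"
  proof (rule field_le_epsilon)
    fix e :: real assume "0 < e"
    then obtain F where F: "finite F" "F \<subseteq> A" "S - e \<le> sum f F" using approx by blast
    have "sum f F \<le> infsum f A" using F nonneg by (intro finite_sum_le_infsum sum) auto
    with F show "S \<le> infsum f A + e" by simp
  qed
  ultimately show ?thesis using has_sum_infsum[OF sum] by simp
qed

context ultrametric_measure_space
begin

lemma density_drop_nonneg: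
  assumes "0 < r"
  shows "0 \<le> 1 / measure m (ball x r) - 1 / measure m (cball x r)"
proof -
  have "measure m (ball x r) \<le> measure m (cball x r)"
    by (intro measure_mono_fmeasurable ball_subset_cball) auto
  with ball_mass_pos[OF assms, of x] show ?thesis by (simp add: frac_le)
qed

text \<open>The drops \<open>1 / measure m (ball x r) - 1 / measure m (cball x r)\<close> are the weights of the spectral
measure; by telescoping, those with \<open>r \<ge> e\<close> have total weight at most \<open>1 / measure m (ball x e)\<close>.\<close>
lemma density_drop_sum_le:
  assumes e: "0 < e" and J: "finite J" "J \<subseteq> distances x \<inter> {e..}"
  shows "(\<Sum>r\<in>J. 1 / measure m (ball x r) - 1 / measure m (cball x r)) \<le> 1 / measure m (ball x e)"
proof -
  define b where "b = Max (insert e J) + 1"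
  have "r \<le> Max (insert e J)" if "r \<in> insert e J" for r using J(1) that by (intro Max_ge) auto
  then have b: "e \<le> b" "\<And>r. r \<in> J \<Longrightarrow> r < b" by (force simp: b_def)+
  have fin: "finite (distances x \<inter> {e..<b})"
    by (rule finite_subset[OF _ finite_distances[OF e, of x b]]) auto
  have "(\<Sum>r\<in>J. 1 / measure m (ball x r) - 1 / measure m (cball x r))
      \<le> (\<Sum>r\<in>distances x \<inter> {e..<b}. 1 / measure m (ball x r) - 1 / measure m (cball x r))"
    using J b density_drop_nonneg[OF distances_pos] by (intro sum_mono2 fin) auto
  also have "\<dots> = 1 / measure m (ball x e) - 1 / measure m (ball x b)"
    by (rule sum_distances_telescope[OF e b(1)])
  also have "\<dots> \<le> 1 / measure m (ball x e)" by simp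
  finally show ?thesis .
qed

end

context ultrametric_measure_space_choice
begin

text \<open>The averaging density of \<open>ball x e\<close> is the sum of the Haar functions for the distances in
\<open>{e..<R}\<close> and of the averaging density of \<open>ball x R\<close>.  The semigroup multiplies the Haar functions by
exponentials.  The remainder has the norm \<open>1 / sqrt (measure m (ball x R))\<close>, which tends to \<open>0\<close>
because the space has infinite mass.\<close>
lemma ball_return_density_has_sum:
  assumes sg: "semigroup_generated_by_minus m A P" and A: "hier_laplacian_graph m C \<subseteq> A"
    and t: "0 \<le> t" and e: "0 < e"
  shows "((\<lambda>r. (1 / measure m (ball x r) - 1 / measure m (cball x r)) * exp (- t * eigval C (cball x r)))
    has_sum L2_inner m (P t (averaging_density m (ball x e))) (averaging_density m (ball x e)))
    (distances x \<inter> {e..})"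
proof -
  note L2P = semigroup_L2[OF sg t]
  define g where "g = (\<lambda>R. averaging_density m (ball x R))"
  define \<phi> where "\<phi> = (\<lambda>f. L2_inner m (P t f) (g e))"
  define I where "I = (\<lambda>R. distances x \<inter> {e..<R})"
  define w where "w = (\<lambda>r. (1 / measure m (ball x r) - 1 / measure m (cball x r)) * exp (- t * eigval C (cball x r)))"
  have g: "g R \<in> L2 m" "L2_norm m (g R) = 1 / sqrt (measure m (ball x R))" if "0 < R" for R
    using averaging_density_L2[OF fmeasurable_balls(1) ball_mass_pos[OF that]] by (simp_all add: g_def)
  have w_nonneg: "0 \<le> w r" if "0 < r" for r
    unfolding w_def using density_drop_nonneg[OF that] by simp
  have finI: "finite (I R)" for R
    unfolding I_def by (rule finite_subset[OF _ finite_distances[OF e, of x R]]) auto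
  have \<phi>_add: "\<phi> (\<lambda>y. f y + h y) = \<phi> f + \<phi> h" if "f \<in> L2 m" "h \<in> L2 m" for f h
  proof -
    have "\<phi> (\<lambda>y. f y + h y) = L2_inner m (\<lambda>y. P t f y + P t h y) (g e)"
      unfolding \<phi>_def using semigroup_linear[OF sg t that, of 1 1] that g(1)[OF e]
      by (intro L2_inner_cong_AE L2_borel L2P L2_add) auto
    also have "\<dots> = \<phi> f + \<phi> h"
      unfolding \<phi>_def by (intro L2_inner_add_left L2P that g e)
    finally show ?thesis .
  qed
  have \<phi>_haar: "\<phi> (haar m x r) = w r" if r: "r \<in> distances x" "e \<le> r" for r
  proof -
    have r0: "0 < r" using distances_pos r by blast
    have "(haar m x r, \<lambda>y. eigval C (cball x r) * haar m x r y) \<in> A"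
      using A haar_test_function[OF r0, of x] haar_eigenfunction[OF r(1)]
      unfolding hier_laplacian_graph_def by force
    then have "AE y in m. P t (haar m x r) y = exp (- eigval C (cball x r) * t) * haar m x r y"
      using eigval_pos[OF distances_nonsingleton[OF r(1)]]
      by (intro semigroup_eigenvector[OF sg haar_L2[OF r0] _ _ t]) auto
    then have "\<phi> (haar m x r) = L2_inner m (\<lambda>y. exp (- eigval C (cball x r) * t) * haar m x r y) (g e)"
      unfolding \<phi>_def by (intro L2_inner_cong_AE L2_borel L2P L2_cmult haar_L2 r0 g e)
    also have "\<dots> = exp (- eigval C (cball x r) * t) * L2_inner m (haar m x r) (g e)"
      by (rule L2_inner_cmult_left)
    also have "L2_inner m (haar m x r) (g e) =
        (LINT y|m. (1 / measure m (ball x r) - 1 / measure m (cball x r)) * g e y)"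
      unfolding L2_inner_def
    proof (rule Bochner_Integration.integral_cong[OF refl])
      fix y
      show "haar m x r y * g e y = (1 / measure m (ball x r) - 1 / measure m (cball x r)) * g e y"
      proof (cases "y \<in> ball x e")
        case True
        then have "y \<in> ball x r" using r(2) by auto
        then show ?thesis by (simp only: haar_inside)
      qed (simp add: g_def averaging_density_def)
    qed
    also have "\<dots> = 1 / measure m (ball x r) - 1 / measure m (cball x r)"
      using averaging_density_integral[OF fmeasurable_balls(1) ball_mass_pos[OF e]]
      by (simp add: g_def)
    finally show ?thesis by (simp add: w_def mult_ac)
  qed
  have expand: "\<phi> (g e) = sum w (I R) + \<phi> (g R)" if R: "e \<le> R" for R
  proof -
    have R0: "0 < R" using e R by simp
    have IR: "r \<in> distances x \<and> e \<le> r" if "r \<in> I R" for r using that by (simp add: I_def)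
    have sum: "(\<lambda>y. \<Sum>r\<in>J. haar m x r y) \<in> L2 m \<and> \<phi> (\<lambda>y. (\<Sum>r\<in>J. haar m x r y) + g R y) = sum w J + \<phi> (g R)"
      if "finite J" "J \<subseteq> I R" for J
      using that
    proof (induction J rule: finite_induct)
      case empty
      then show ?case by (simp add: L2_zero)
    next
      case (insert r J)
      then have r: "r \<in> distances x" "e \<le> r" "haar m x r \<in> L2 m"
        using IR[of r] haar_L2[OF distances_pos] by auto
      have "\<phi> (\<lambda>y. haar m x r y + ((\<Sum>r\<in>J. haar m x r y) + g R y)) =
          \<phi> (haar m x r) + \<phi> (\<lambda>y. (\<Sum>r\<in>J. haar m x r y) + g R y)"
        using insert r R0 by (intro \<phi>_add L2_add g) auto
      with insert r show ?case by (simp add: \<phi>_haar add.assoc L2_add)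
    qed
    have "g e y = (\<Sum>r\<in>I R. haar m x r y) + g R y" for y
      using sum_distances_telescope[OF e R, of "\<lambda>B. averaging_density m B y" x]
      by (simp add: g_def haar_def I_def)
    then have "g e = (\<lambda>y. (\<Sum>r\<in>I R. haar m x r y) + g R y)" by auto
    with sum[OF finI subset_refl] show ?thesis by simp
  qed
  obtain K where K: "\<forall>f\<in>L2 m. L2_norm m (P t f) \<le> K * L2_norm m f"
    using semigroup_bounded[OF sg t] by blast
  have "((\<lambda>R. \<phi> (g R)) \<longlongrightarrow> 0) at_top"
  proof (rule tendsto_0_le[where K = 1])
    have "((\<lambda>R. K * L2_norm m (g e) * inverse (sqrt (measure m (ball x R)))) \<longlongrightarrow> K * L2_norm m (g e) * 0) at_top"
      by (intro tendsto_mult tendsto_const tendsto_inverse_0_at_top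
          filterlim_compose[OF sqrt_at_top ball_mass_at_top])
    then show "((\<lambda>R. K * L2_norm m (g e) * inverse (sqrt (measure m (ball x R)))) \<longlongrightarrow> 0) at_top" by simp
    show "\<forall>\<^sub>F R in at_top. norm (\<phi> (g R)) \<le> norm (K * L2_norm m (g e) * inverse (sqrt (measure m (ball x R)))) * 1"
      using eventually_gt_at_top[of 0]
    proof eventually_elim
      case (elim R)
      have "\<bar>\<phi> (g R)\<bar> \<le> L2_norm m (P t (g R)) * L2_norm m (g e)"
        unfolding \<phi>_def by (intro L2_Cauchy_Schwarz L2P g elim e)
      also have "\<dots> \<le> (K * L2_norm m (g R)) * L2_norm m (g e)"
        using K g(1)[OF elim] by (intro mult_right_mono L2_norm_nonneg) auto
      also have "\<dots> = K * L2_norm m (g e) * inverse (sqrt (measure m (ball x R)))"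
        by (simp add: g(2)[OF elim] divide_inverse)
      finally show ?case by simp
    qed
  qed
  then have "((\<lambda>R. \<phi> (g e) - \<phi> (g R)) \<longlongrightarrow> \<phi> (g e) - 0) at_top" by (intro tendsto_intros)
  moreover have "\<forall>\<^sub>F R in at_top. \<phi> (g e) - \<phi> (g R) = sum w (I R)"
    using eventually_ge_at_top[of e] by eventually_elim (simp add: expand)
  ultimately have lim: "((\<lambda>R. sum w (I R)) \<longlongrightarrow> \<phi> (g e)) at_top"
    by (simp add: tendsto_cong)
  have "(w has_sum \<phi> (g e)) (distances x \<inter> {e..})"
  proof (rule nonneg_has_sumI)
    fix F assume F: "finite F" "F \<subseteq> distances x \<inter> {e..}"
    show "sum w F \<le> \<phi> (g e)"
    proof (rule tendsto_lowerbound[OF lim])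
      show "\<forall>\<^sub>F R in at_top. sum w F \<le> sum w (I R)"
        using eventually_gt_at_top[of "Max (insert e F)"]
      proof eventually_elim
        case (elim R)
        then have "F \<subseteq> I R" using F by (auto simp: I_def)
        then show ?case using w_nonneg distances_pos by (intro sum_mono2 finI) (auto simp: I_def)
      qed
    qed simp
  next
    fix d :: real assume "0 < d"
    then have "\<forall>\<^sub>F R in at_top. \<phi> (g e) - d < sum w (I R)"
      by (intro order_tendstoD(1)[OF lim]) simp
    then obtain R where "\<phi> (g e) - d < sum w (I R)"
      using eventually_happens'[OF trivial_limit_at_top_linorder] by blast
    then show "\<exists>F. finite F \<and> F \<subseteq> distances x \<inter> {e..} \<and> \<phi> (g e) - d \<le> sum w F"
      using finI by (intro exI[of _ "I R"]) (auto simp: I_def)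
  qed (use w_nonneg distances_pos in auto)
  then show ?thesis by (simp add: w_def \<phi>_def g_def)
qed

text \<open>The inner product is the average of \<open>p t\<close> over \<open>ball x e \<times> ball x e\<close>, so it tends to \<open>p t x x\<close> by
continuity of the kernel.\<close>
lemma ball_return_density_tendsto:
  assumes sg: "semigroup_generated_by_minus m A P" and p: "continuous_kernel_of m P p" and t: "0 < t"
  shows "((\<lambda>e. L2_inner m (P t (averaging_density m (ball x e))) (averaging_density m (ball x e)))
    \<longlongrightarrow> p t x x) (at_right 0)"
proof (rule tendstoI)
  fix \<eta> :: real assume "0 < \<eta>"
  then have "0 < \<eta> / 2" by simp
  have "continuous_on UNIV (\<lambda>(y, z). p t y z)" using p t by (simp add: continuous_kernel_of_def)
  then obtain d where d: "0 < d" "\<And>w. dist w (x, x) < d \<Longrightarrow> dist ((\<lambda>(y, z). p t y z) w) (p t x x) < \<eta> / 2"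
    using \<open>0 < \<eta> / 2\<close> unfolding continuous_on_iff by (metis UNIV_I case_prod_conv)
  have close: "\<bar>p t y z - p t x x\<bar> \<le> \<eta> / 2" if "y \<in> ball x e" "z \<in> ball x e" "e < d / 2" for y z e
  proof -
    have "dist (y, z) (x, x) \<le> dist y x + dist z x"
      unfolding dist_Pair_Pair by (rule sqrt_sum_squares_le_sum) auto
    then have "dist (y, z) (x, x) < d" using that by (simp add: dist_commute)
    from d(2)[OF this] show ?thesis by (simp add: dist_real_def)
  qed
  have "\<forall>\<^sub>F e in at_right 0. 0 < e \<and> e < d / 2"
    using d(1) by (auto simp: eventually_at_right_field intro: exI[of _ "d / 2"])
  then show "\<forall>\<^sub>F e in at_right 0. dist (L2_inner m (P t (averaging_density m (ball x e))) (averaging_density m (ball x e))) (p t x x) < \<eta>"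
  proof eventually_elim
    case (elim e)
    define g where "g = averaging_density m (ball x e)"
    have pos: "0 < measure m (ball x e)" using elim by (intro ball_mass_pos) auto
    have gL2: "g \<in> L2 m" unfolding g_def by (intro averaging_density_L2 fmeasurable_balls pos)
    have "AE y in m. integrable m (\<lambda>z. p t y z * g z) \<and> P t g y = (LINT z|m. p t y z * g z)"
      using p t gL2 by (simp add: continuous_kernel_of_def)
    then have "AE y in m. y \<in> ball x e \<longrightarrow> \<bar>P t g y - p t x x\<bar> \<le> \<eta> / 2"
    proof eventually_elim
      case (elim y)
      show ?case
      proof
        assume y: "y \<in> ball x e"
        have "\<bar>(LINT z|m. p t y z * g z) - p t x x\<bar> \<le> \<eta> / 2"
          unfolding g_def
        proof (rule average_close[OF fmeasurable_balls(1) pos])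
          show "integrable m (\<lambda>z. p t y z * averaging_density m (ball x e) z)"
            using elim by (simp add: g_def)
          show "AE z in m. z \<in> ball x e \<longrightarrow> \<bar>p t y z - p t x x\<bar> \<le> \<eta> / 2"
            using close[OF y] \<open>0 < e \<and> e < d / 2\<close> by (intro AE_I2) blast
        qed
        with elim show "\<bar>P t g y - p t x x\<bar> \<le> \<eta> / 2" by simp
      qed
    qed
    moreover have "integrable m (\<lambda>y. P t g y * g y)"
      using t by (intro L2_integrable_prod semigroup_L2[OF sg] gL2) auto
    ultimately have "\<bar>L2_inner m (P t g) g - p t x x\<bar> \<le> \<eta> / 2"
      unfolding L2_inner_def g_def by (intro average_close[OF fmeasurable_balls(1) pos])
    with \<open>0 < \<eta>\<close> show ?case by (simp add: dist_real_def g_def)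
  qed
qed

text \<open>The spectral formula for the on-diagonal heat kernel: let \<open>e\<close> tend to \<open>0\<close> in the partial sums over
the distances \<open>r \<ge> e\<close>.\<close>
lemma heat_kernel_diagonal_has_sum:
  assumes p: "continuous_heat_kernel m C p" and t: "0 < t"
  shows "((\<lambda>r. (1 / measure m (ball x r) - 1 / measure m (cball x r)) * exp (- t * eigval C (cball x r)))
    has_sum p t x x) (distances x)"
proof -
  obtain A P where A: "hier_laplacian_graph m C \<subseteq> A" and sg: "semigroup_generated_by_minus m A P"
    and k: "continuous_kernel_of m P p"
    using p unfolding continuous_heat_kernel_def self_adjoint_extension_def by blast
  define w where "w = (\<lambda>r. (1 / measure m (ball x r) - 1 / measure m (cball x r)) * exp (- t * eigval C (cball x r)))"
  define S where "S = (\<lambda>e. L2_inner m (P t (averaging_density m (ball x e))) (averaging_density m (ball x e)))"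
  have w_nonneg: "0 \<le> w r" if "r \<in> distances x" for r
    unfolding w_def using density_drop_nonneg[OF distances_pos[OF that]] by simp
  have S: "(w has_sum S e) (distances x \<inter> {e..})" if "0 < e" for e
    unfolding w_def S_def using t by (intro ball_return_density_has_sum[OF sg A _ that]) simp
  have lim: "(S \<longlongrightarrow> p t x x) (at_right 0)"
    unfolding S_def by (rule ball_return_density_tendsto[OF sg k t])
  have "(w has_sum p t x x) (distances x)"
  proof (rule nonneg_has_sumI)
    fix F assume F: "finite F" "F \<subseteq> distances x"
    define b where "b = Min (insert 1 F)"
    have b: "0 < b" "\<And>r. r \<in> F \<Longrightarrow> b \<le> r"
      using F distances_pos by (auto simp: b_def)
    show "sum w F \<le> p t x x"
    proof (rule tendsto_lowerbound[OF lim])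
      show "\<forall>\<^sub>F e in at_right 0. sum w F \<le> S e"
        unfolding eventually_at_right_field
      proof (intro exI[of _ b] conjI allI impI b(1))
        fix e assume e: "0 < e" "e < b"
        show "sum w F \<le> S e"
          using F b e w_nonneg by (intro finite_sum_le_has_sum[OF S[OF e(1)]]) (auto dest: b(2))
      qed
    qed simp
  next
    fix d :: real assume "0 < d"
    then have "\<forall>\<^sub>F e in at_right 0. p t x x - d / 2 < S e"
      by (intro order_tendstoD(1)[OF lim]) simp
    moreover have "\<forall>\<^sub>F e::real in at_right 0. 0 < e" by (rule eventually_at_right_less)
    ultimately have "\<forall>\<^sub>F e in at_right 0. p t x x - d / 2 < S e \<and> 0 < e" by eventually_elim simp
    then obtain e where e: "p t x x - d / 2 < S e" "0 < e"
      using eventually_happens'[OF trivial_limit_at_right_real] by blast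
    obtain F where F: "finite F" "F \<subseteq> distances x \<inter> {e..}" "dist (sum w F) (S e) \<le> d / 2"
      using has_sum_finite_approximation[OF S[OF e(2)], of "d / 2"] \<open>0 < d\<close> by auto
    have "p t x x - d \<le> sum w F" using F(3) e(1) unfolding dist_real_def by linarith
    with F show "\<exists>F. finite F \<and> F \<subseteq> distances x \<and> p t x x - d \<le> sum w F" by blast
  qed (rule w_nonneg)
  then show ?thesis by (simp add: w_def)
qed

end

section \<open>Absence of regular variation\<close>

context homogeneous_hierarchical_laplacian
begin

lemma intrinsic_vol_not_varies_regularly: "\<not> varies_regularly (\<lambda>t. intrinsic_vol m C x t)"
proof (rule doubling_jumps_not_varies_regularly[OF intrinsic_vol_pos])
  have "\<exists>T\<ge>b. \<forall>s<T. 2 * intrinsic_vol m C x s \<le> intrinsic_vol m C x T" for b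
  proof -
    define T where "T = max b 1"
    then have T: "0 < T" "b \<le> T" by simp_all
    obtain r where r: "r \<in> distances x" "eigval C (cball x r) < 1 / T"
      using eigval_small[of "1 / T" x 0] T(1) by auto
    have "T < 1 / eigval C (cball x r)"
      using r(2) eigval_pos[OF distances_nonsingleton[OF r(1)]] T(1) by (simp add: field_simps)
    with T(2) intrinsic_vol_jump[OF r(1)]
    show ?thesis by (intro exI[of _ "1 / eigval C (cball x r)"]) auto
  qed
  then show "\<exists>\<^sub>F T in at_top. \<forall>s<T. 2 * intrinsic_vol m C x s \<le> intrinsic_vol m C x T"
    unfolding frequently_def eventually_at_top_linorder by blast
qed

text \<open>The eigenvalues decrease along the distances, so the spectral weight of the eigenvalues up to that of
\<open>cball x r\<close> is at most \<open>1 / measure m (ball x r)\<close>.  Since \<open>cball x r\<close> has at least twice the mass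
of \<open>ball x r\<close>, at least half of this bound sits at the eigenvalue of \<open>cball x r\<close> itself.\<close>
lemma heat_kernel_not_varies_regularly:
  assumes p: "continuous_heat_kernel m C p"
  shows "\<not> varies_regularly (\<lambda>t. 1 / p t x x)"
proof (rule atomic_laplace_transform_not_varies_regularly[OF _ _ heat_kernel_diagonal_has_sum[OF p]])
  have half: "1 / measure m (ball x r) \<le> 2 * (1 / measure m (ball x r) - 1 / measure m (cball x r))"
    if "r \<in> distances x" for r
  proof -
    have "1 / measure m (cball x r) \<le> 1 / (2 * measure m (ball x r))"
      using ball_mass_doubling[OF that] ball_mass_pos[OF distances_pos[OF that], of x]
      by (intro divide_left_mono) auto
    then show ?thesis by simp
  qed
  fix r assume r: "r \<in> distances x"
  show "0 < 1 / measure m (ball x r) - 1 / measure m (cball x r)"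
    using half[OF r] ball_mass_pos[OF distances_pos[OF r], of x] by (smt (verit) divide_pos_pos)
  show "0 < eigval C (cball x r)" by (rule eigval_pos[OF distances_nonsingleton[OF r]])
next
  fix e :: real assume "0 < e"
  then obtain r where r: "r \<in> distances x" "eigval C (cball x r) < e" using eigval_small by blast
  have "sum (\<lambda>r. 1 / measure m (ball x r) - 1 / measure m (cball x r)) J \<le>
      2 * (1 / measure m (ball x r) - 1 / measure m (cball x r))"
    if J: "finite J" "J \<subseteq> {s \<in> distances x. eigval C (cball x s) \<le> eigval C (cball x r)}" for J
  proof -
    have "J \<subseteq> distances x \<inter> {r..}"
      using J(2) eigval_decreasing[OF _ r(1)] by (force simp: not_le[symmetric])
    from density_drop_sum_le[OF distances_pos[OF r(1)] J(1) this]
    have "sum (\<lambda>r. 1 / measure m (ball x r) - 1 / measure m (cball x r)) J \<le> 1 / measure m (ball x r)" .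
    moreover have "1 / measure m (cball x r) \<le> 1 / (2 * measure m (ball x r))"
      using ball_mass_doubling[OF r(1)] ball_mass_pos[OF distances_pos[OF r(1)], of x]
      by (intro divide_left_mono) auto
    ultimately show ?thesis by simp
  qed
  with r show "\<exists>r\<in>distances x. eigval C (cball x r) < e \<and>
      (\<forall>J. finite J \<longrightarrow> J \<subseteq> {s \<in> distances x. eigval C (cball x s) \<le> eigval C (cball x r)} \<longrightarrow>
        sum (\<lambda>r. 1 / measure m (ball x r) - 1 / measure m (cball x r)) J
        \<le> 2 * (1 / measure m (ball x r) - 1 / measure m (cball x r)))" by blast
qed

end

theorem proposition2p4:
  fixes m :: "'a::metric_space measure" and C :: "'a set \<Rightarrow> real"
    and p :: "real \<Rightarrow> 'a \<Rightarrow> 'a \<Rightarrow> real" and x :: 'a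
  assumes "homogeneous_hierarchical_laplacian m C"
    and "continuous_heat_kernel m C p"
  shows "\<not> varies_regularly (\<lambda>t. 1 / p t x x) \<and>
         \<not> varies_regularly (\<lambda>t. 1 / spectral_fun m C x (1 / t)) \<and>
         \<not> varies_regularly (\<lambda>t. intrinsic_vol m C x t)"
proof -
  interpret homogeneous_hierarchical_laplacian m C by fact
  show ?thesis
    using heat_kernel_not_varies_regularly[OF assms(2)] intrinsic_vol_not_varies_regularly
    by (simp add: spectral_fun_def)
qed

end
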